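(* Let $K$ be a compact metric space, and let $(K_i)_i$ be its homogeneous components. Assume that there are only countably many homogeneous components. For each $i$ such that $K_i$ admits a non-zero non-negative finite isometrically compatible Borel measure, denote by $\mu_i$ its unique isometrically compatible probability, and denote by $I$ the set of such $i$. Then $\mu$ is an isometrically compatible probability on $K$ if and only if there is a family $(\lambda_i)_{i\in I}$ of non-negative real numbers such that $\sum_{i\in I}\lambda_i=1$ and $\mu=\sum_{i\in I}\lambda_i\mu_i$. Consequently, the space of isometrically compatible probabilities of $K$ is a compact convex set (for the weak-$*$ topology) whose extreme points are the isometrically compatible probabilities supported on homogeneous components of $K$ admitting an isometrically compatible probability.
   Context: On a metric space $K$ define the homogeneity equivalence: $x\leftrightarrow y$ if and only if there are $\varepsilon>0$ and an isometry from the open ball $B(x;\varepsilon)$ onto the open ball $B(y;\varepsilon)$. The homogeneous components of $K$ are the equivalence classes of $\leftrightarrow$ (they are Borel sets when $K$ is compact), each endowed with the induced distance. An isometrically compatible measure on a metric space $E$ is a measure $m$ defined on the Borel sets of $E$ such that $m(U)=m(V)$ for every pair $(U,V)$ of open sets of $E$ for which there is an isometry from $U$ onto $V$. The measure $\mu_i$ on $K_i$ is viewed as a measure on $K$ by $B\mapsto\mu_i(B\cap K_i)$.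
   Formalization: In the homogeneity equivalence, the isometry from B(x;ε) onto B(y;ε) is required to send x to y; without this all points of a compact space are equivalent and uniqueness of the probability on a component fails, e.g. for [0,1] together with an isolated point. *)

theory Defs
  imports "HOL-Probability.Probability"
begin

definition isometry_onto :: "('a::metric_space \<Rightarrow> 'a) \<Rightarrow> 'a set \<Rightarrow> 'a set \<Rightarrow> bool" where
  "isometry_onto f U V \<longleftrightarrow> f ` U = V \<and> (\<forall>x\<in>U. \<forall>y\<in>U. dist (f x) (f y) = dist x y)"

text \<open>
  The isometry between the two balls has to map centre to centre. Without this requirement any
  two points of a bounded space would be related, by the identity on a ball that is the whole space.
\<close>

definition homogeneity :: "('a::metric_space \<times> 'a) set" where
  "homogeneity = {(x, y). \<exists>\<epsilon>>0. \<exists>f. isometry_onto f (ball x \<epsilon>) (ball y \<epsilon>) \<and> f x = y}"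

definition homogeneous_components :: "'a::metric_space set set" where
  "homogeneous_components = UNIV // homogeneity"

text \<open>
  The metric space \<open>E\<close> is given as a subset with the induced distance, so its open sets are the
  relatively open ones, and its Borel sets are those of \<^term>\<open>restrict_space borel E\<close>.
\<close>

definition isometrically_compatible :: "'a::metric_space set \<Rightarrow> 'a measure \<Rightarrow> bool" where
  "isometrically_compatible E m \<longleftrightarrow>
     sets m = sets (restrict_space borel E) \<and>
     (\<forall>U V f. openin (top_of_set E) U \<and> openin (top_of_set E) V \<and> isometry_onto f U V \<longrightarrow>
        emeasure m U = emeasure m V)"

definition isometrically_compatible_prob :: "'a::metric_space set \<Rightarrow> 'a measure \<Rightarrow> bool" where
  "isometrically_compatible_prob E m \<longleftrightarrow> isometrically_compatible E m \<and> prob_space m"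

definition compatible_probs :: "'a::metric_space measure set" where
  "compatible_probs = {\<mu>. isometrically_compatible_prob UNIV \<mu>}"

definition admissible_components :: "'a::metric_space set set" where
  "admissible_components = {C \<in> homogeneous_components.
     \<exists>m. isometrically_compatible C m \<and> finite_measure m \<and> emeasure m (space m) \<noteq> 0}"

definition component_prob :: "'a::metric_space set \<Rightarrow> 'a measure" where
  "component_prob C = (THE m. isometrically_compatible_prob C m)"

text \<open>
  A finite Borel measure is regarded as an element of the dual of the space of continuous functions
  (on a compact space, all continuous functions are bounded). The weak-* topology on this dual is
  the topology of pointwise convergence, which is \<^const>\<open>strong_operator_topology\<close> for operators
  into \<^typ>\<open>real\<close>.
\<close>

definition dual_functional :: "'a::metric_space measure \<Rightarrow> ('a \<Rightarrow>\<^sub>C real) \<Rightarrow>\<^sub>L real" where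
  "dual_functional m = Blinfun (\<lambda>f. integral\<^sup>L m (apply_bcontfun f))"

abbreviation weak_star_topology :: "('b::real_normed_vector \<Rightarrow>\<^sub>L real) topology" where
  "weak_star_topology \<equiv> strong_operator_topology"

lemma integrable_bcontfun:
  fixes f :: "'a::metric_space \<Rightarrow>\<^sub>C real"
  assumes "sets m = sets borel" "finite_measure m"
  shows "integrable m (apply_bcontfun f)"
proof -
  interpret finite_measure m by fact
  have "apply_bcontfun f \<in> borel_measurable m"
    unfolding measurable_cong_sets[OF assms(1) refl]
    by (intro borel_measurable_continuous_onI continuous_on_apply_bcontfun)
  then show ?thesis
    by (intro integrable_const_bound[where B="norm f"]) (auto simp: norm_bounded simp flip: real_norm_def)
qed

lemma dual_functional_apply:
  fixes f :: "'a::metric_space \<Rightarrow>\<^sub>C real"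
  assumes "sets m = sets borel" "finite_measure m"
  shows "blinfun_apply (dual_functional m) f = integral\<^sup>L m (apply_bcontfun f)"
proof -
  interpret finite_measure m by fact
  have "bounded_linear (\<lambda>f :: 'a \<Rightarrow>\<^sub>C real. integral\<^sup>L m (apply_bcontfun f))"
  proof (rule bounded_linear_intro[where K="measure m (space m)"])
    fix f :: "'a \<Rightarrow>\<^sub>C real"
    have "\<bar>integral\<^sup>L m (apply_bcontfun f)\<bar> \<le> integral\<^sup>L m (\<lambda>x. \<bar>apply_bcontfun f x\<bar>)"
      by (rule integral_abs_bound)
    also have "\<dots> \<le> integral\<^sup>L m (\<lambda>x. norm f)"
      using norm_bounded[of f]
      by (intro integral_mono integrable_abs integrable_bcontfun[OF assms]) auto
    finally show "norm (integral\<^sup>L m (apply_bcontfun f)) \<le> norm f * measure m (space m)"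
      by (simp add: mult.commute)
  qed (simp_all add: integrable_bcontfun[OF assms])
  then show ?thesis
    by (simp add: dual_functional_def bounded_linear_Blinfun_apply)
qed

lemma inj_on_dual_functional:
  "inj_on dual_functional {m :: 'a::metric_space measure. sets m = sets borel \<and> finite_measure m}"
proof (rule inj_onI, clarify)
  fix m n :: "'a measure"
  assume m: "sets m = sets borel" "finite_measure m" and n: "sets n = sets borel" "finite_measure n"
    and eq: "dual_functional m = dual_functional n"
  have int_eq: "integral\<^sup>L m (apply_bcontfun f) = integral\<^sup>L n (apply_bcontfun f)" for f :: "'a \<Rightarrow>\<^sub>C real"
    using eq dual_functional_apply[OF m, of f] dual_functional_apply[OF n, of f] by simp
  have closed_eq: "measure m S = measure n S" if "closed S" for S :: "'a set"
  proof (cases "S = {}")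
    case False
    define g where "g = (\<lambda>(k::nat) x. max 0 (1 - real k * infdist x S))"
    have g_cont: "continuous_on UNIV (g k)" for k
      unfolding g_def by (intro continuous_intros)
    have g_bd: "\<bar>g k x\<bar> \<le> 1" for k x
      by (auto simp: g_def infdist_nonneg)
    have "g k \<in> bcontfun" for k
      using g_cont g_bd by (intro bcontfun_normI[where b=1]) auto
    then have g_int: "integral\<^sup>L m (g k) = integral\<^sup>L n (g k)" for k
      using int_eq[of "Bcontfun (g k)"] by (simp add: Bcontfun_inverse)
    have g_lim: "(\<lambda>k. g k x) \<longlonglongrightarrow> indicator S x" for x
    proof (cases "x \<in> S")
      case True
      then show ?thesis by (simp add: g_def)
    next
      case x: False
      then have "infdist x S > 0"
        using that False by (metis in_closed_iff_infdist_zero infdist_nonneg less_eq_real_def)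
      then obtain N where N: "1 < real N * infdist x S"
        using reals_Archimedean3 by blast
      have "1 \<le> real k * infdist x S" if "N \<le> k" for k
        using mult_right_mono[of "real N" "real k" "infdist x S"] N that infdist_nonneg[of x S] by simp
      then have "\<forall>\<^sub>F k in sequentially. g k x = 0"
        unfolding g_def eventually_sequentially by (intro exI[of _ N]) auto
      then show ?thesis
        using x by (simp add: tendsto_eventually)
    qed
    have *: "(\<lambda>k. integral\<^sup>L p (g k)) \<longlonglongrightarrow> measure p S"
      if p: "sets p = sets borel" "finite_measure p" for p
    proof -
      interpret finite_measure p by fact
      have S: "S \<in> sets p" using \<open>closed S\<close> p by simp
      have "(\<lambda>k. integral\<^sup>L p (g k)) \<longlonglongrightarrow> integral\<^sup>L p (indicator S)"
        using g_lim g_bd g_cont S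
        by (intro integral_dominated_convergence[where w="\<lambda>_. 1"])
           (auto simp: measurable_cong_sets[OF p(1) refl] p(1)
                 intro: borel_measurable_continuous_onI borel_measurable_indicator)
      then show ?thesis using S by (simp add: integral_indicator sets.Int_space_eq2)
    qed
    show ?thesis
      using LIMSEQ_unique[OF *[OF m]] *[OF n] g_int by simp
  qed simp
  interpret m: finite_measure m by fact
  interpret n: finite_measure n by fact
  show "m = n"
  proof (rule measure_eqI_generator_eq[where E="Collect closed" and \<Omega>=UNIV and A="\<lambda>_::nat. UNIV"])
    show "Int_stable (Collect closed :: 'a set set)"
      by (auto intro!: Int_stableI)
    show "emeasure m X = emeasure n X" if "X \<in> Collect closed" for X
      using closed_eq[of X] that by (simp add: m.emeasure_eq_measure n.emeasure_eq_measure)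
    show "sets m = sigma_sets UNIV (Collect closed)" "sets n = sigma_sets UNIV (Collect closed)"
      using m n by (auto simp: borel_eq_closed)
  qed auto
qed

end

theory Submission
  imports Defs
begin

text \<open>
  Points of a component \<open>C\<close> have isometric balls, but the admissible radius depends on the points. Since
  there are only countably many components and each is a countable union of closed sets, Baire's
  theorem in the closure of \<open>C\<close> makes the radius locally uniform on \<open>C\<close>. Two finite measures whose
  small balls have locally constant measure are then proportional, by Fubini's theorem on the set of
  pairs at distance less than \<open>r\<close>. This gives uniqueness on \<open>C\<close>; applied to the restriction of
  \<open>\<mu>\<close> to a relatively open \<open>U\<close> and its pullback along an isometry \<open>U \<rightarrow> V\<close> inside \<open>C\<close>, it also
  shows that a compatible measure on the whole space restricts to a compatible measure on \<open>C\<close>, although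
  the isometry need not extend to open sets of the space. Isometries between open sets preserve every
  component, which gives the converse and the splitting of a probability charging two components.
  Weak-* compactness is reduced to Helly's theorem by a Borel embedding of the space into the reals.
\<close>

section \<open>Isometric balls and homogeneous components\<close>

text \<open>Everything about measures is reduced to the function
  \<open>r \<mapsto> measure m (C \<inter> ball y r)\<close>. The isometries that define a component
  act between balls of the whole space, while those that test a measure on \<open>C\<close> act
  between relatively open pieces of \<open>C\<close>. Both kinds carry small traces
  \<open>C \<inter> ball y r\<close> onto such traces, and this is their common ground. The Fubini
  argument integrates the ball measure over an open region at one radius and then shrinks the
  radius, so one bound on the radii has to serve all points of the region. Baire's theorem in turn
  needs closed sets, which come from fixing the radius: \<open>ball_equiv e\<close> has closed
  classes because isometries of balls and their inverses can be passed to the limit together in a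
  compact product. For weak limits the direction of continuity matters: the embedding into the reals
  is only shown to be Borel, but its inverse is uniformly continuous and extends to the closure of
  the range, so continuous functions on the space become continuous functions on a closed set of
  reals.\<close>

lemma isometry_onto_image_ball:
  assumes "isometry_onto f U V" "x \<in> U"
  shows "f ` (U \<inter> ball x r) = V \<inter> ball (f x) r"
  using assms unfolding isometry_onto_def by auto

lemma isometry_onto_subset:
  assumes "isometry_onto f U V" "W \<subseteq> U"
  shows "isometry_onto f W (f ` W)"
  using assms unfolding isometry_onto_def by (simp add: subset_iff)

lemma isometry_onto_comp:
  assumes "isometry_onto f U V" "isometry_onto g V W"
  shows "isometry_onto (g \<circ> f) U W"
  using assms unfolding isometry_onto_def by (auto simp: image_comp [symmetric])

lemma isometry_onto_inj_on:
  assumes "isometry_onto f U V"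
  shows "inj_on f U"
  using assms unfolding isometry_onto_def inj_on_def by (metis dist_eq_0_iff)

lemma isometry_onto_inv_into:
  assumes "isometry_onto f U V"
  shows "isometry_onto (inv_into U f) V U"
proof -
  have fU: "f ` U = V" and d: "\<And>x y. x \<in> U \<Longrightarrow> y \<in> U \<Longrightarrow> dist (f x) (f y) = dist x y"
    using assms by (auto simp: isometry_onto_def)
  have "inv_into U f ` V = U"
    using isometry_onto_inj_on[OF assms] fU by (metis inv_into_image_cancel order_refl)
  moreover have "dist (inv_into U f x) (inv_into U f y) = dist x y" if "x \<in> V" "y \<in> V" for x y
    using that d fU by (metis f_inv_into_f inv_into_into)
  ultimately show ?thesis
    by (simp add: isometry_onto_def)
qed

lemma isometry_onto_continuous_on:
  assumes "isometry_onto f U V"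
  shows "continuous_on U f"
  using assms unfolding isometry_onto_def continuous_on_iff by fastforce

lemma isometry_onto_openin:
  assumes f: "isometry_onto f U V" and W: "openin (top_of_set U) W"
  shows "openin (top_of_set V) (f ` W)"
proof -
  have inv: "isometry_onto (inv_into U f) V U"
    by (rule isometry_onto_inv_into[OF f])
  have "W \<subseteq> U"
    using W openin_imp_subset by blast
  then have "f ` W = V \<inter> inv_into U f -` W"
    using f isometry_onto_inj_on[OF f] by (auto simp: isometry_onto_def f_inv_into_f image_iff)
  moreover have "inv_into U f \<in> V \<rightarrow> U"
    using inv by (auto simp: isometry_onto_def)
  ultimately show ?thesis
    using continuous_openin_preimage[OF isometry_onto_continuous_on[OF inv] _ W] by simp
qed

text \<open>Homogeneity at a prescribed radius. For each \<open>e > 0\<close> this is an equivalence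
  relation, with closed classes when the space is compact; \<open>homogeneity\<close> is the union
  of these relations, which grow as \<open>e\<close> decreases.\<close>

definition ball_equiv :: "real \<Rightarrow> 'a::metric_space \<Rightarrow> 'a \<Rightarrow> bool" where
  "ball_equiv e x y \<longleftrightarrow> (\<exists>f. isometry_onto f (ball x e) (ball y e) \<and> f x = y)"

text \<open>Preserving distances only sends the ball into the ball around \<open>f x\<close>; that
  the image is the full ball is due to \<open>ball (f x) e\<close> lying in the image
  \<open>V\<close>.\<close>

lemma ball_equiv_isometry:
  assumes f: "isometry_onto f U V" and "x \<in> U" "ball x e \<subseteq> U" "ball (f x) e \<subseteq> V"
  shows "ball_equiv e x (f x)"
proof -
  have "f ` ball x e = ball (f x) e"
    using isometry_onto_image_ball[OF f \<open>x \<in> U\<close>, of e] assms by (simp add: Int_absorb1)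
  then show ?thesis
    using isometry_onto_subset[OF f \<open>ball x e \<subseteq> U\<close>] unfolding ball_equiv_def by auto
qed

lemma ball_equiv_refl: "ball_equiv e x x"
  unfolding ball_equiv_def isometry_onto_def by (rule exI[of _ id]) simp

lemma ball_equiv_mono:
  assumes "ball_equiv e x y" "0 < d" "d \<le> e"
  shows "ball_equiv d x y"
proof -
  obtain f where f: "isometry_onto f (ball x e) (ball y e)" "f x = y"
    using assms(1) by (auto simp: ball_equiv_def)
  show ?thesis
    using ball_equiv_isometry[OF f(1), of x d] f(2) assms(2,3) by (auto simp: subset_ball)
qed

lemma ball_equiv_sym:
  assumes "ball_equiv e x y" "0 < e"
  shows "ball_equiv e y x"
proof -
  obtain f where f: "isometry_onto f (ball x e) (ball y e)" "f x = y"
    using assms(1) by (auto simp: ball_equiv_def)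
  have "inv_into (ball x e) f y = x"
    using f isometry_onto_inj_on[OF f(1)] assms(2) by (metis centre_in_ball inv_into_f_f)
  then show ?thesis
    using isometry_onto_inv_into[OF f(1)] unfolding ball_equiv_def by auto
qed

lemma ball_equiv_trans:
  assumes "ball_equiv e x y" "ball_equiv e y z"
  shows "ball_equiv e x z"
  using assms isometry_onto_comp unfolding ball_equiv_def by (metis comp_apply)

lemma homogeneity_iff: "(x, y) \<in> homogeneity \<longleftrightarrow> (\<exists>e>0. ball_equiv e x y)"
  by (auto simp: homogeneity_def ball_equiv_def)

lemma equiv_homogeneity: "equiv UNIV (homogeneity :: ('a::metric_space \<times> 'a) set)"
proof (rule equivI)
  show "refl (homogeneity :: ('a \<times> 'a) set)"
    by (rule refl_onI) (use homogeneity_iff ball_equiv_refl zero_less_one in blast)+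
  show "sym (homogeneity :: ('a \<times> 'a) set)"
    by (rule symI) (use homogeneity_iff ball_equiv_sym in blast)
  show "trans (homogeneity :: ('a \<times> 'a) set)"
  proof (rule transI)
    fix x y z :: 'a
    assume "(x, y) \<in> homogeneity" "(y, z) \<in> homogeneity"
    then obtain d e where de: "0 < d" "0 < e" "ball_equiv d x y" "ball_equiv e y z"
      by (auto simp: homogeneity_iff)
    then have "ball_equiv (min d e) x z"
      by (intro ball_equiv_trans[of _ x y z]) (auto intro: ball_equiv_mono)
    then show "(x, z) \<in> homogeneity"
      using de by (auto simp: homogeneity_iff intro!: exI[of _ "min d e"])
  qed
qed simp

lemma component_mem_iff:
  assumes "C \<in> homogeneous_components" "x \<in> C"
  shows "y \<in> C \<longleftrightarrow> (\<exists>e>0. ball_equiv e x y)"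
proof -
  have "y \<in> C \<longleftrightarrow> (x, y) \<in> homogeneity"
    using assms in_quotient_imp_closed[OF equiv_homogeneity, of C x y]
      in_quotient_imp_in_rel[OF equiv_homogeneity, of C x y]
    unfolding homogeneous_components_def by blast
  then show ?thesis
    by (simp add: homogeneity_iff)
qed

lemma component_nonempty:
  assumes "C \<in> homogeneous_components"
  shows "C \<noteq> {}"
  using assms in_quotient_imp_non_empty[OF equiv_homogeneity]
  unfolding homogeneous_components_def by blast

lemma Union_components: "\<Union>homogeneous_components = UNIV"
  unfolding homogeneous_components_def by (rule Union_quotient[OF equiv_homogeneity])

lemma components_disjoint:
  assumes "C \<in> homogeneous_components" "D \<in> homogeneous_components" "C \<noteq> D"
  shows "C \<inter> D = {}"
  using assms quotient_disj[OF equiv_homogeneity] unfolding homogeneous_components_def by blast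

text \<open>On a small ball around \<open>x\<close> the map is itself a ball isometry sending centre
  to centre, so no point leaves its component. Openness of \<open>U\<close> and \<open>V\<close> in
  the whole space provides the ball.\<close>

lemma isometry_mem_component_iff:
  assumes f: "isometry_onto f U V" "open U" "open V" and x: "x \<in> U"
    and C: "C \<in> homogeneous_components"
  shows "f x \<in> C \<longleftrightarrow> x \<in> C"
proof -
  have "f x \<in> V"
    using f x by (auto simp: isometry_onto_def)
  then obtain d e where de: "0 < d" "0 < e" "ball x d \<subseteq> U" "ball (f x) e \<subseteq> V"
    using f x by (meson openE)
  define r where "r = min d e"
  have r: "0 < r" "ball x r \<subseteq> U" "ball (f x) r \<subseteq> V"
    using de by (auto simp: r_def)
  have 1: "ball_equiv r x (f x)"
    by (rule ball_equiv_isometry[OF f(1) x r(2,3)])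
  have 2: "ball_equiv r (f x) x"
    by (rule ball_equiv_sym[OF 1 r(1)])
  show ?thesis
  proof
    show "x \<in> C" if "f x \<in> C"
      using component_mem_iff[OF C that] 2 r(1) by blast
    show "f x \<in> C" if "x \<in> C"
      using component_mem_iff[OF C that] 1 r(1) by blast
  qed
qed

lemma isometry_image_component:
  assumes f: "isometry_onto f U V" "open U" "open V" and C: "C \<in> homogeneous_components"
  shows "f ` (U \<inter> C) = V \<inter> C"
proof -
  have V: "V = f ` U"
    using f(1) by (simp add: isometry_onto_def)
  show ?thesis
    unfolding V using isometry_mem_component_iff[OF f _ C] by blast
qed

section \<open>Limits of isometries between balls; components are Borel\<close>

lemma compact_fun_UNIV:
  assumes "compact (UNIV :: 'a::topological_space set)"
  shows "compact (UNIV :: ('b \<Rightarrow> 'a) set)"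
proof -
  have "compact_space (product_topology (\<lambda>_::'b. euclidean :: 'a topology) UNIV)"
    using assms by (intro iffD2[OF compact_space_product_topology]) (simp add: compact_space_def)
  then show ?thesis
    by (simp add: compact_space_def euclidean_product_topology)
qed

text \<open>Replaces the choice of a convergent subsequence: it is applied in a product over all
  points of the space, where compactness need not yield convergent subsequences.\<close>

lemma compact_cluster_filter:
  fixes h :: "nat \<Rightarrow> 'b::topological_space"
  assumes "compact (UNIV :: 'b set)"
  obtains l G where "G \<noteq> bot" "G \<le> sequentially" "(h \<longlongrightarrow> l) G"
proof -
  obtain l where l: "inf (nhds l) (filtermap h sequentially) \<noteq> bot"
    using assms[unfolded compact_filter, rule_format, of "filtermap h sequentially"]
    by (auto simp: filtermap_bot_iff)
  define G where "G = inf (filtercomap h (nhds l)) sequentially"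
  have "G \<noteq> bot"
  proof
    assume "G = bot"
    then have "eventually (\<lambda>_. False) G"
      by simp
    then obtain P Q where PQ: "eventually P (filtercomap h (nhds l))" "eventually Q sequentially"
        "\<And>k. P k \<Longrightarrow> Q k \<Longrightarrow> False"
      unfolding G_def eventually_inf by auto
    from PQ(1) obtain R where R: "eventually R (nhds l)" "\<And>k. R (h k) \<Longrightarrow> P k"
      by (auto simp: eventually_filtercomap)
    have "eventually (\<lambda>q. \<not> R q) (filtermap h sequentially)"
      unfolding eventually_filtermap using PQ(2) by eventually_elim (use PQ R in blast)
    then have "eventually (\<lambda>_. False) (inf (nhds l) (filtermap h sequentially))"
      unfolding eventually_inf using R(1) by blast
    then show False
      using l by (simp add: trivial_limit_def)
  qed
  moreover have "(h \<longlongrightarrow> l) G"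
    unfolding G_def by (rule filterlim_mono[OF filterlim_filtercomap order_refl inf_le1])
  ultimately show ?thesis
    by (intro that[of G l]) (auto simp: G_def)
qed

text \<open>A limit of isometries preserves distances, but its surjectivity is not automatic. The
  inverses are therefore passed to the limit along the same filter and supply the preimages.\<close>

lemma closed_ball_equiv:
  fixes x :: "'a::metric_space"
  assumes compact: "compact (UNIV :: 'a set)" and e: "0 < e"
  shows "closed {y. ball_equiv e x y}"
  unfolding closed_sequential_limits
proof (intro allI impI, elim conjE)
  fix y :: "nat \<Rightarrow> 'a" and l
  assume "\<forall>k. y k \<in> {y. ball_equiv e x y}" and lim: "y \<longlonglongrightarrow> l"
  then have "\<forall>k. \<exists>f. isometry_onto f (ball x e) (ball (y k) e) \<and> f x = y k"
    by (auto simp: ball_equiv_def)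
  then obtain f where f: "\<And>k. isometry_onto (f k) (ball x e) (ball (y k) e)" and fx: "\<And>k. f k x = y k"
    by metis
  define g where "g k = inv_into (ball x e) (f k)" for k
  have fd: "dist (f k u) (f k v) = dist u v" if "u \<in> ball x e" "v \<in> ball x e" for k u v
    using f[of k] that by (auto simp: isometry_onto_def)
  have g: "g k w \<in> ball x e" "f k (g k w) = w" if "w \<in> ball (y k) e" for k w
  proof -
    have "w \<in> f k ` ball x e"
      using f[of k] that by (simp add: isometry_onto_def)
    then show "g k w \<in> ball x e" "f k (g k w) = w"
      unfolding g_def by (rule inv_into_into, rule f_inv_into_f)
  qed
  \<comment> \<open>The functions are total: outside their balls \<open>f k\<close> and
    \<open>g k\<close> take arbitrary values, but these lie in a compact space too and do not
    prevent a cluster point.\<close>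
  have "compact (UNIV :: (('a \<Rightarrow> 'a) \<times> ('a \<Rightarrow> 'a)) set)"
    using compact_Times[OF compact_fun_UNIV[OF compact] compact_fun_UNIV[OF compact]] by simp
  then obtain q G where G: "G \<noteq> bot" "G \<le> sequentially" "((\<lambda>k. (f k, g k)) \<longlongrightarrow> q) G"
    using compact_cluster_filter by blast
  have limf: "((\<lambda>k. f k u) \<longlongrightarrow> fst q u) G" and limg: "((\<lambda>k. g k u) \<longlongrightarrow> snd q u) G" for u
  proof -
    have coord: "((\<lambda>k. h k u) \<longlongrightarrow> p u) G" if "(h \<longlongrightarrow> p) G" for h :: "nat \<Rightarrow> 'a \<Rightarrow> 'a" and p
      by (rule continuous_on_tendsto_compose[where s = UNIV and f = "\<lambda>h. h u", OF _ that])
        (auto intro: continuous_on_product_coordinates)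
    show "((\<lambda>k. f k u) \<longlongrightarrow> fst q u) G" "((\<lambda>k. g k u) \<longlongrightarrow> snd q u) G"
      using coord[OF tendsto_fst[OF G(3)]] coord[OF tendsto_snd[OF G(3)]] by simp_all
  qed
  have limy: "(y \<longlongrightarrow> l) G"
    using filterlim_mono[OF lim order_refl G(2)] .
  have qx: "fst q x = l"
    using limf[of x] by (intro tendsto_unique[OF G(1) _ limy]) (simp add: fx)
  have dist: "dist (fst q u) (fst q v) = dist u v" if uv: "u \<in> ball x e" "v \<in> ball x e" for u v
  proof (rule tendsto_unique[OF G(1)])
    show "((\<lambda>k. dist (f k u) (f k v)) \<longlongrightarrow> dist (fst q u) (fst q v)) G"
      by (rule tendsto_dist[OF limf limf])
  qed (simp add: fd[OF uv])
  have "fst q ` ball x e = ball l e"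
  proof (intro equalityI subsetI)
    show "w \<in> ball l e" if w: "w \<in> fst q ` ball x e" for w
      using w dist[of x] e qx by auto
    \<comment> \<open>Such a \<open>w\<close> lies in \<open>ball (y k) e\<close> only eventually.
      The limit of the preimages \<open>g k w\<close> stays in the open ball, because its distance
      from \<open>x\<close> is exactly \<open>dist l w < e\<close>.\<close>
    fix w assume w: "w \<in> ball l e"
    have evw: "\<forall>\<^sub>F k in G. w \<in> ball (y k) e"
      using order_tendstoD(2)[OF tendsto_dist[OF limy tendsto_const[of w]], of e] w by simp
    have "\<forall>\<^sub>F k in G. dist x (g k w) = dist (y k) w"
      using evw
    proof eventually_elim
      case (elim k)
      then show ?case
        using fd[of x "g k w" k] g[OF elim] e by (simp add: fx)
    qed
    then have "((\<lambda>k. dist x (g k w)) \<longlongrightarrow> dist l w) G"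
      using tendsto_dist[OF limy tendsto_const[of w]] by (rule iffD2[OF tendsto_cong])
    with tendsto_dist[OF tendsto_const limg] have "dist x (snd q w) = dist l w"
      by (rule tendsto_unique[OF G(1)])
    then have z: "snd q w \<in> ball x e"
      using w by simp
    have "\<forall>\<^sub>F k in G. dist (f k (snd q w)) w = dist (snd q w) (g k w)"
      using evw
    proof eventually_elim
      case (elim k)
      then show ?case
        using fd[of "snd q w" "g k w" k] g[OF elim] z by simp
    qed
    moreover have "((\<lambda>k. dist (snd q w) (g k w)) \<longlongrightarrow> 0) G"
      using tendsto_dist[OF tendsto_const limg[of w], of "snd q w"] by simp
    ultimately have "((\<lambda>k. dist (f k (snd q w)) w) \<longlongrightarrow> 0) G"
      by (rule iffD2[OF tendsto_cong])
    with tendsto_dist[OF limf tendsto_const] have "dist (fst q (snd q w)) w = 0"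
      by (rule tendsto_unique[OF G(1)])
    then show "w \<in> fst q ` ball x e"
      using z by (metis dist_eq_0_iff imageI)
  qed
  then show "l \<in> {y. ball_equiv e x y}"
    using dist qx unfolding ball_equiv_def isometry_onto_def by blast
qed

lemma ball_equiv_scale:
  assumes "0 < e" "ball_equiv e x y"
  obtains n where "ball_equiv (1 / Suc n) x y"
proof -
  obtain n where "1 / real (Suc n) < e"
    using nat_approx_posE[OF assms(1)] by blast
  then have "ball_equiv (1 / Suc n) x y"
    by (intro ball_equiv_mono[OF assms(2)]) auto
  then show ?thesis
    by (rule that)
qed

text \<open>In a compact space the pieces are closed, so this exhibits a component as an F-sigma
  set.\<close>

lemma component_eq_UN:
  assumes "C \<in> homogeneous_components" "x \<in> C"
  shows "C = (\<Union>n. {y. ball_equiv (1 / Suc n) x y})"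
proof (intro equalityI subsetI)
  fix y assume "y \<in> C"
  then obtain e where "0 < e" "ball_equiv e x y"
    using component_mem_iff[OF assms] by blast
  then obtain n where "ball_equiv (1 / Suc n) x y"
    by (rule ball_equiv_scale)
  then show "y \<in> (\<Union>n. {y. ball_equiv (1 / Suc n) x y})"
    by blast
next
  fix y assume "y \<in> (\<Union>n. {y. ball_equiv (1 / Suc n) x y})"
  then obtain n where "ball_equiv (1 / Suc n) x y"
    by blast
  moreover have "0 < 1 / real (Suc n)"
    by simp
  ultimately show "y \<in> C"
    using component_mem_iff[OF assms] by blast
qed

lemma component_borel:
  fixes C :: "'a::metric_space set"
  assumes "compact (UNIV :: 'a set)" "C \<in> homogeneous_components"
  shows "C \<in> sets borel"
proof -
  obtain x where "x \<in> C"
    using component_nonempty[OF assms(2)] by blast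
  then show ?thesis
    using closed_ball_equiv[OF assms(1)]
    by (subst component_eq_UN[OF assms(2)]) (auto intro!: sets.countable_UN borel_closed)
qed

text \<open>
  The closure of a component is a countable union of components, each of them a countable union of
  closed sets, so by the Baire category theorem the component is somewhere of uniform scale, and by
  homogeneity it is so everywhere.
\<close>

lemma component_locally_uniform:
  fixes C :: "'a::metric_space set"
  assumes compact: "compact (UNIV :: 'a set)" and countable: "countable (homogeneous_components :: 'a set set)"
    and C: "C \<in> homogeneous_components" and x: "x \<in> C"
  obtains d where "0 < d" "\<And>y. y \<in> C \<Longrightarrow> y \<in> ball x d \<Longrightarrow> ball_equiv d x y"
proof -
  define X where "X = top_of_set (closure C)"
  define p where "p D = (SOME x::'a. x \<in> D)" for D
  have p: "p D \<in> D" if "D \<in> homogeneous_components" for D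
    unfolding p_def using component_nonempty[OF that] by (simp add: some_in_eq)
  define \<G> where "\<G> = (\<lambda>(D, n). closure C \<inter> {y. ball_equiv (1 / Suc n) (p D) y}) ` (homogeneous_components \<times> (UNIV :: nat set))"
  have comp: "compact (closure C)"
    using compact closed_Int_compact[of "closure C" UNIV] by simp
  have "locally_compact_space X" "regular_space X"
    unfolding X_def using comp
    by (auto intro!: compact_imp_locally_compact_space metrizable_imp_regular_space
        metrizable_space_subtopology metrizable_space_euclidean simp: compact_space_subtopology)
  moreover have "countable \<G>"
    unfolding \<G>_def using countable by auto
  moreover have "closedin X T" if "T \<in> \<G>" for T
    using that closed_ball_equiv[OF compact] unfolding X_def \<G>_def
    by (auto intro!: closedin_closed_Int)
  moreover have "\<Union>\<G> = closure C"
  proof (intro equalityI subsetI)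
    fix y assume y: "y \<in> closure C"
    obtain D where D: "D \<in> homogeneous_components" "y \<in> D"
      using Union_components by blast
    then obtain n where "ball_equiv (1 / Suc n) (p D) y"
      using component_eq_UN[OF D(1) p[OF D(1)]] by blast
    then show "y \<in> \<Union>\<G>"
      using D y by (auto simp: \<G>_def)
  qed (auto simp: \<G>_def)
  moreover have "X interior_of closure C \<noteq> {}"
    using x closure_subset interior_of_topspace[of X] by (auto simp: X_def)
  ultimately have "\<not> (\<forall>T\<in>\<G>. X interior_of T = {})"
    using Baire_category_alt[of X \<G>] by auto
  then obtain T where T: "T \<in> \<G>" "X interior_of T \<noteq> {}"
    by blast
  obtain D n where Dn: "D \<in> homogeneous_components" "T = closure C \<inter> {y. ball_equiv (1 / Suc n) (p D) y}"
    using T(1) by (auto simp: \<G>_def)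
  define e where "e = 1 / real (Suc n)"
  have e: "0 < e"
    by (simp add: e_def)
  have "openin X (X interior_of T)"
    by (rule openin_interior_of)
  then obtain O' where O': "open O'" "X interior_of T = closure C \<inter> O'"
    unfolding X_def openin_open by blast
  \<comment> \<open>The piece with interior comes from a base point in some component
    \<open>D\<close>; density of \<open>C\<close> in its closure brings a point of \<open>C\<close>
    into that interior.\<close>
  then have "O' \<inter> C \<noteq> {}"
    using T(2) open_Int_closure_eq_empty[of O' C] by (simp add: Int_commute)
  then obtain z where z: "z \<in> C" "z \<in> O'"
    by auto
  obtain \<delta> where \<delta>: "0 < \<delta>" "ball z \<delta> \<subseteq> O'"
    using O' z by (meson openE)
  have T': "ball_equiv e (p D) y" if "y \<in> C" "y \<in> O'" for y
    using that O'(2) interior_of_subset[of X T] closure_subset[of C] Dn(2)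
    unfolding e_def by blast
  have uni: "ball_equiv e z y" if "y \<in> C" "y \<in> ball z \<delta>" for y
  proof (rule ball_equiv_trans)
    show "ball_equiv e z (p D)"
      by (rule ball_equiv_sym[OF T'[OF z] e])
    show "ball_equiv e (p D) y"
      using that \<delta>(2) by (intro T') auto
  qed
  obtain \<eta> where \<eta>: "0 < \<eta>" "ball_equiv \<eta> z x"
    using component_mem_iff[OF C z(1)] x by auto
  then obtain f where f: "isometry_onto f (ball z \<eta>) (ball x \<eta>)" "f z = x"
    by (auto simp: ball_equiv_def)
  \<comment> \<open>Halving makes every ball of radius \<open>d\<close> around a point of
    \<open>ball z d\<close> fit into \<open>ball z \<eta>\<close>, and likewise around
    \<open>x\<close>.\<close>
  define d where "d = min (min \<eta> \<delta>) e / 2"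
  have d: "0 < d" "d \<le> e" "d \<le> \<eta>" "d < \<delta>" "2 * d \<le> \<eta>"
    using \<delta> \<eta> e by (auto simp: d_def)
  \<comment> \<open>With \<open>w\<close> the preimage of \<open>y\<close>, the isometry
    \<open>f\<close> links \<open>z\<close> to \<open>x\<close> and \<open>w\<close> to
    \<open>y\<close>, and uniformity around \<open>z\<close> links \<open>z\<close> to
    \<open>w\<close>.\<close>
  have "ball_equiv d x y" if y: "y \<in> C" "y \<in> ball x d" for y
  proof -
    have "y \<in> f ` ball z \<eta>"
      using y d f(1) by (auto simp: isometry_onto_def)
    then obtain w where w: "w \<in> ball z \<eta>" "y = f w"
      by auto
    have "dist z w = dist x y"
      using f w \<eta>(1) by (auto simp: isometry_onto_def)
    then have wd: "w \<in> ball z d"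
      using y by simp
    have sub: "ball u d \<subseteq> ball v \<eta>" if "u \<in> ball v d" for u v :: 'a
    proof
      fix t assume "t \<in> ball u d"
      then show "t \<in> ball v \<eta>"
        using that d(5) dist_triangle[of v t u] by simp
    qed
    have wy: "ball_equiv d w y"
      unfolding w(2) by (rule ball_equiv_isometry[OF f(1) w(1)]) (use sub wd y w in auto)
    have "w \<in> C"
      using component_mem_iff[OF C y(1)] ball_equiv_sym[OF wy] d(1) by auto
    then have "ball_equiv e z w"
      using uni[of w] wd d by auto
    then have "ball_equiv d z w"
      using d(1,2) by (rule ball_equiv_mono)
    moreover have "ball_equiv d x z"
      by (rule ball_equiv_mono[OF ball_equiv_sym[OF \<eta>(2,1)] d(1,3)])
    ultimately show ?thesis
      using wy ball_equiv_trans by blast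
  qed
  then show ?thesis
    using d(1) that by blast
qed

section \<open>Measures with locally constant ball measures\<close>

text \<open>The type is merely a metric space, so the separability behind the measurability
  arguments is extracted from compactness.\<close>

lemma compact_imp_countable_dense:
  assumes "compact (UNIV :: 'a::metric_space set)"
  obtains D :: "'a::metric_space set" where "countable D" "\<And>x e. 0 < e \<Longrightarrow> \<exists>p\<in>D. dist x p < e"
proof -
  have "\<exists>k. finite k \<and> (UNIV :: 'a set) \<subseteq> (\<Union>x\<in>k. ball x (1 / Suc n))" for n
    using assms unfolding compact_eq_totally_bounded by simp
  then obtain k where k: "\<And>n. finite (k n)" "\<And>n. (UNIV :: 'a set) \<subseteq> (\<Union>x\<in>k n. ball x (1 / Suc n))"
    by metis
  have "\<exists>p\<in>\<Union>(range k). dist x p < e" if e: "0 < e" for x e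
  proof -
    obtain n where n: "1 / real (Suc n) < e"
      using nat_approx_posE[OF e] by blast
    obtain p where "p \<in> k n" "dist p x < 1 / Suc n"
      using k(2)[of n] by (meson UN_iff UNIV_I mem_ball subsetD)
    then show ?thesis
      using n by (auto simp: dist_commute intro!: bexI[of _ p])
  qed
  moreover have "countable (\<Union>(range k))"
    using k(1) by (simp add: uncountable_infinite countable_finite)
  ultimately show ?thesis
    using that by blast
qed

lemma compact_imp_countable_base:
  assumes "compact (UNIV :: 'a::metric_space set)"
  obtains \<B> :: "'a::metric_space set set" where "countable \<B>" "\<And>b. b \<in> \<B> \<Longrightarrow> open b"
    "\<And>U x. open U \<Longrightarrow> x \<in> U \<Longrightarrow> \<exists>b\<in>\<B>. x \<in> b \<and> b \<subseteq> U"
proof -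
  obtain D :: "'a set" where D: "countable D" "\<And>x e. 0 < e \<Longrightarrow> \<exists>p\<in>D. dist x p < e"
    using compact_imp_countable_dense[OF assms] by blast
  define \<B> where "\<B> = (\<lambda>(p, n). ball p (1 / Suc n)) ` (D \<times> (UNIV :: nat set))"
  have "\<exists>b\<in>\<B>. x \<in> b \<and> b \<subseteq> U" if U: "open U" "x \<in> U" for U x
  proof -
    obtain e where e: "0 < e" "ball x e \<subseteq> U"
      using openE[OF U] by blast
    obtain n where n: "1 / real (Suc n) < e / 2"
      using nat_approx_posE[of "e / 2"] e by auto
    obtain p where p: "p \<in> D" "dist x p < 1 / real (Suc n)"
      using D(2)[of "1 / real (Suc n)" x] by auto
    have "ball p (1 / Suc n) \<subseteq> ball x e"
    proof
      fix t assume "t \<in> ball p (1 / Suc n)"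
      then show "t \<in> ball x e"
        using p n dist_triangle[of x t p] by simp
    qed
    then show ?thesis
      using p e by (auto simp: \<B>_def dist_commute intro!: bexI[of _ "ball p (1 / Suc n)"])
  qed
  moreover have "countable \<B>"
    using D(1) by (simp add: \<B>_def)
  moreover have "open b" if "b \<in> \<B>" for b
    using that by (auto simp: \<B>_def)
  ultimately show ?thesis
    using that by blast
qed

section \<open>Fubini's theorem near the diagonal\<close>

lemma sets_trace_borel:
  fixes T :: "'a::topological_space set"
  assumes "T \<in> sets borel"
  shows "sets (restrict_space borel T) = sigma_sets T ((\<inter>) T ` {S. open S})"
  using sigma_sets_Int[of T UNIV "{S. open S}"] assms
  by (simp add: sets_restrict_space borel_def)

text \<open>The triangle inequality through a point \<open>p\<close> of a countable dense set, with
  the length \<open>r\<close> split as \<open>q\<close> and \<open>r - q\<close> for rational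
  \<open>q\<close>, writes the set as a countable union of measurable rectangles.\<close>

lemma near_diagonal_measurable:
  fixes m n :: "'a::metric_space measure"
  assumes compact: "compact (UNIV :: 'a set)"
    and m: "sets m = sets (restrict_space borel T)" and n: "sets n = sets (restrict_space borel T)"
  shows "{(x, y). x \<in> T \<and> y \<in> T \<and> dist x y < r} \<in> sets (m \<Otimes>\<^sub>M n)"
proof -
  obtain D :: "'a set" where D: "countable D" "\<And>x e. 0 < e \<Longrightarrow> \<exists>p\<in>D. dist x p < e"
    using compact_imp_countable_dense[OF compact] by blast
  have "{(x, y). x \<in> T \<and> y \<in> T \<and> dist x y < r} =
    (\<Union>p\<in>D. \<Union>q\<in>\<rat>. (T \<inter> ball p q) \<times> (T \<inter> ball p (r - q)))" (is "?L = ?R")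
  proof (intro equalityI subsetI)
    fix z assume "z \<in> ?L"
    then obtain x y where z: "z = (x, y)" "x \<in> T" "y \<in> T" "dist x y < r"
      by auto
    then obtain p where p: "p \<in> D" "dist x p < (r - dist x y) / 2"
      using D(2)[of "(r - dist x y) / 2" x] by auto
    then have "dist p x < r - dist p y"
      using dist_triangle[of p y x] by (simp add: dist_commute field_simps)
    then obtain q where "q \<in> \<rat>" "dist p x < q" "q < r - dist p y"
      using Rats_dense_in_real by blast
    then have "z \<in> (T \<inter> ball p q) \<times> (T \<inter> ball p (r - q))"
      using z by auto
    then show "z \<in> ?R"
      using p(1) \<open>q \<in> \<rat>\<close> by blast
  next
    fix z assume "z \<in> ?R"
    then obtain x y p q where z: "z = (x, y)" "x \<in> T" "y \<in> T" "dist p x < q" "dist p y < r - q"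
      by auto
    then show "z \<in> ?L"
      using dist_triangle[of x y p] by (auto simp: dist_commute)
  qed
  moreover have "T \<inter> ball p q \<in> sets m" "T \<inter> ball p q \<in> sets n" for p q
    unfolding m n by (auto simp: sets_restrict_space)
  ultimately show ?thesis
    using D(1) countable_rat by (auto intro!: sets.countable_UN'')
qed

text \<open>
  Fubini's theorem for the set of pairs of distance less than \<open>r\<close>; as \<open>r\<close> tends to 0, this compares
  the two measures up to the ratio of their ball measures.
\<close>

lemma uniform_measures_compare:
  fixes m n :: "'a::metric_space measure"
  assumes compact: "compact (UNIV :: 'a set)"
    and m: "sets m = sets (restrict_space borel T)" "finite_measure m"
    and n: "sets n = sets (restrict_space borel T)" "finite_measure n"
    and W: "open W" and r: "0 < r"
    and g: "\<And>y. y \<in> T \<Longrightarrow> y \<in> W \<Longrightarrow> measure m (T \<inter> ball y r) = a"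
    and h: "\<And>y. y \<in> T \<Longrightarrow> y \<in> W \<Longrightarrow> measure n (T \<inter> ball y r) = b"
  shows "b * measure m (T \<inter> {x. ball x r \<subseteq> W}) \<le> a * measure n (T \<inter> W)"
proof (cases "T \<inter> W = {}")
  case True
  then have "T \<inter> {x. ball x r \<subseteq> W} = {}"
    using r by (auto simp: subset_iff)
  then show ?thesis
    by (simp add: True)
next
  case False
  interpret m: finite_measure m by fact
  interpret n: finite_measure n by fact
  interpret pair_sigma_finite m n ..
  have spm: "space m = T" and spn: "space n = T"
    using sets_eq_imp_space_eq[OF m(1)] sets_eq_imp_space_eq[OF n(1)] by (simp_all add: space_restrict_space)
  have ab: "0 \<le> a" "0 \<le> b"
    using False g h measure_nonneg by blast+
  have "- {x. ball x r \<subseteq> W} = (\<Union>w\<in>-W. ball w r)"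
    by (auto simp: dist_commute)
  then have "closed {x. ball x r \<subseteq> W}"
    by (simp add: closed_def open_UN)
  then have Wr: "T \<inter> {x. ball x r \<subseteq> W} \<in> sets m" (is "?Wr \<in> _")
    unfolding m sets_restrict_space by auto
  have TW: "T \<inter> W \<in> sets n"
    unfolding n sets_restrict_space using W by auto
  have T: "T \<inter> ball y r \<in> sets m" for y
    unfolding m sets_restrict_space by auto
  \<comment> \<open>Only pairs whose first point has its whole \<open>r\<close>-ball inside
    \<open>W\<close> are kept. Then the nonempty slices at \<open>x\<close> are full traces of
    balls, and the slices at \<open>y\<close> are empty unless \<open>y \<in> W\<close>, so ball
    measures are only used at points of \<open>W\<close>.\<close>
  define P where "P = {(x, y). x \<in> T \<and> y \<in> T \<and> dist x y < r} \<inter> ?Wr \<times> space n"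
  have P: "P \<in> sets (m \<Otimes>\<^sub>M n)"
    unfolding P_def using near_diagonal_measurable[OF compact m(1) n(1)] Wr by auto
  have "Pair x -` P = T \<inter> ball x r" "x \<in> W" if "x \<in> ?Wr" for x
    using that r by (auto simp: P_def spn)
  then have slice: "emeasure n (Pair x -` P) = ennreal b * indicator ?Wr x" for x
    using h[of x] by (cases "x \<in> ?Wr") (auto simp: n.emeasure_eq_measure P_def)
  have "ennreal b * emeasure m ?Wr = (\<integral>\<^sup>+x. ennreal b * indicator ?Wr x \<partial>m)"
    using Wr by (simp add: nn_integral_cmult_indicator)
  also have "\<dots> = emeasure (m \<Otimes>\<^sub>M n) P"
    by (simp add: n.emeasure_pair_measure_alt[OF P] slice)
  also have "\<dots> = (\<integral>\<^sup>+y. emeasure m ((\<lambda>x. (x, y)) -` P) \<partial>n)"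
    by (rule emeasure_pair_measure_alt2[OF P])
  also have "\<dots> \<le> (\<integral>\<^sup>+y. ennreal a * indicator (T \<inter> W) y \<partial>n)"
  proof (rule nn_integral_mono)
    fix y assume y: "y \<in> space n"
    show "emeasure m ((\<lambda>x. (x, y)) -` P) \<le> ennreal a * indicator (T \<inter> W) y"
    proof (cases "y \<in> W")
      case True
      have "emeasure m ((\<lambda>x. (x, y)) -` P) \<le> emeasure m (T \<inter> ball y r)"
        by (rule emeasure_mono[OF _ T]) (auto simp: P_def dist_commute)
      then show ?thesis
        using True y g[of y] by (simp add: m.emeasure_eq_measure[of "T \<inter> ball y r"] spn)
    next
      case False
      then have "(\<lambda>x. (x, y)) -` P = {}"
        by (auto simp: P_def subset_iff)
      then show ?thesis
        by simp
    qed
  qed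
  also have "\<dots> = ennreal a * emeasure n (T \<inter> W)"
    using TW by (simp add: nn_integral_cmult_indicator)
  finally show ?thesis
    using ab by (simp add: m.emeasure_eq_measure n.emeasure_eq_measure ennreal_mult[symmetric])
qed

text \<open>The comparison on \<open>V\<close> is multiplied by the comparison on \<open>W\<close>
  with the two measures exchanged. The positive factor \<open>g r * h r\<close> cancels, so no
  information about \<open>g r / h r\<close> as \<open>r\<close> tends to 0 is called for; the inner
  sets then exhaust \<open>V\<close> and \<open>W\<close>.\<close>

lemma uniform_measures_proportional_open:
  fixes m n :: "'a::metric_space measure"
  assumes compact: "compact (UNIV :: 'a set)"
    and m: "sets m = sets (restrict_space borel T)" "finite_measure m"
    and n: "sets n = sets (restrict_space borel T)" "finite_measure n"
    and pos: "\<And>r. 0 < r \<Longrightarrow> 0 < g r" "\<And>r. 0 < r \<Longrightarrow> 0 < h r"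
    and V: "open V" "0 < d"
      "\<And>y r. y \<in> T \<Longrightarrow> y \<in> V \<Longrightarrow> 0 < r \<Longrightarrow> r < d \<Longrightarrow> measure m (T \<inter> ball y r) = g r \<and> measure n (T \<inter> ball y r) = h r"
    and W: "open W" "0 < e"
      "\<And>y r. y \<in> T \<Longrightarrow> y \<in> W \<Longrightarrow> 0 < r \<Longrightarrow> r < e \<Longrightarrow> measure m (T \<inter> ball y r) = g r \<and> measure n (T \<inter> ball y r) = h r"
  shows "measure m (T \<inter> V) * measure n (T \<inter> W) \<le> measure n (T \<inter> V) * measure m (T \<inter> W)"
proof -
  have lim: "(\<lambda>k. measure p (T \<inter> {x. ball x (1 / Suc k) \<subseteq> U})) \<longlonglongrightarrow> measure p (T \<inter> U)"
    if p: "sets p = sets (restrict_space borel T)" "finite_measure p" and U: "open U"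
    for p :: "'a measure" and U
  proof -
    interpret finite_measure p by fact
    define A where "A k = T \<inter> {x. ball x (1 / Suc k) \<subseteq> U}" for k
    have "- {x. ball x s \<subseteq> U} = (\<Union>w\<in>-U. ball w s)" for s
      by (auto simp: dist_commute)
    then have "closed {x. ball x s \<subseteq> U}" for s
      by (simp add: closed_def open_UN)
    then have "range A \<subseteq> sets p"
      unfolding p sets_restrict_space A_def by auto
    moreover have "ball x (1 / Suc l) \<subseteq> ball x (1 / Suc k)" if "k \<le> l" for x :: 'a and k l
      using that by (intro subset_ball) (simp add: frac_le)
    then have "incseq A"
      unfolding incseq_def A_def by blast
    ultimately have "(\<lambda>k. measure p (A k)) \<longlonglongrightarrow> measure p (\<Union>k. A k)"
      by (rule finite_Lim_measure_incseq)
    moreover have "(\<Union>k. A k) = T \<inter> U"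
    proof (intro equalityI subsetI)
      fix x assume x: "x \<in> T \<inter> U"
      then obtain s where s: "0 < s" "ball x s \<subseteq> U"
        using U by (meson IntD2 openE)
      obtain k where "1 / real (Suc k) < s"
        using nat_approx_posE[OF s(1)] by blast
      then have "ball x (1 / Suc k) \<subseteq> U"
        using s subset_ball[of "1 / Suc k" s x] by auto
      then show "x \<in> (\<Union>k. A k)"
        using x by (auto simp: A_def)
    next
      fix x assume "x \<in> (\<Union>k. A k)"
      then obtain k where "x \<in> T" "ball x (1 / Suc k) \<subseteq> U"
        by (auto simp: A_def)
      moreover have "x \<in> ball x (1 / Suc k)"
        by simp
      ultimately show "x \<in> T \<inter> U"
        by blast
    qed
    ultimately show ?thesis
      by (simp add: A_def)
  qed
  obtain k0 where k0: "1 / real (Suc k0) < min d e"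
    using nat_approx_posE[of "min d e"] V(2) W(2) by auto
  have "measure m (T \<inter> {x. ball x (1 / Suc k) \<subseteq> V}) * measure n (T \<inter> {x. ball x (1 / Suc k) \<subseteq> W})
      \<le> measure n (T \<inter> V) * measure m (T \<inter> W)" (is "?a * ?c \<le> ?b * ?e") if "k0 \<le> k" for k
  proof -
    define r where "r = 1 / real (Suc k)"
    have "r \<le> 1 / real (Suc k0)"
      using that by (simp add: r_def frac_le)
    then have r: "0 < r" "r < d" "r < e"
      using k0 by (auto simp: r_def)
    have "h r * ?a \<le> g r * ?b"
      unfolding r_def[symmetric]
      by (rule uniform_measures_compare[OF compact m n V(1) r(1)]) (use V(3) r in auto)
    moreover have "g r * ?c \<le> h r * ?e"
      unfolding r_def[symmetric]
      by (rule uniform_measures_compare[OF compact n m W(1) r(1)]) (use W(3) r in auto)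
    ultimately have "(h r * ?a) * (g r * ?c) \<le> (g r * ?b) * (h r * ?e)"
      by (rule mult_mono) (use pos[OF r(1)] in auto)
    then have "(g r * h r) * (?a * ?c) \<le> (g r * h r) * (?b * ?e)"
      by (simp add: ac_simps)
    then show ?thesis
      using pos[OF r(1)] by (simp add: mult_le_cancel_left_pos)
  qed
  then show ?thesis
    by (intro LIMSEQ_le_const2[OF tendsto_mult[OF lim[OF m V(1)] lim[OF n W(1)]]]) blast
qed

text \<open>The functions \<open>g\<close> and \<open>h\<close> are the same around all points of
  \<open>T\<close>; only the range of admissible radii is local. Two small open sets can therefore
  be compared however far apart they are, and a single constant of proportionality serves all of
  \<open>T\<close>.\<close>

lemma uniform_measures_proportional:
  fixes m n :: "'a::metric_space measure"
  assumes compact: "compact (UNIV :: 'a set)"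
    and m: "sets m = sets (restrict_space borel T)" "finite_measure m"
    and n: "sets n = sets (restrict_space borel T)" "finite_measure n"
    and pos: "\<And>r. 0 < r \<Longrightarrow> 0 < g r" "\<And>r. 0 < r \<Longrightarrow> 0 < h r"
    and T: "T \<in> sets borel"
    and uniform: "\<And>x. x \<in> T \<Longrightarrow> \<exists>d>0. \<forall>y r. y \<in> T \<longrightarrow> y \<in> ball x d \<longrightarrow> 0 < r \<longrightarrow> r < d \<longrightarrow>
      measure m (T \<inter> ball y r) = g r \<and> measure n (T \<inter> ball y r) = h r"
    and A: "A \<in> sets m" and B: "B \<in> sets m"
  shows "measure m A * measure n B = measure n A * measure m B"
proof (cases "T = {}")
  case True
  then have "A = {}" "B = {}"
    using A B m(1) by (auto simp: sets_restrict_space)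
  then show ?thesis
    by simp
next
  case False
  interpret m: finite_measure m by fact
  interpret n: finite_measure n by fact
  \<comment> \<open>Open sets on which one bound for the radii works. They are stable under
    intersection, and on \<open>T\<close> every open set is a countable union of them, so their
    traces form a generating pi-system.\<close>
  define small where "small W \<longleftrightarrow> open W \<and> (\<exists>d>0. \<forall>y r. y \<in> T \<longrightarrow> y \<in> W \<longrightarrow> 0 < r \<longrightarrow> r < d \<longrightarrow>
      measure m (T \<inter> ball y r) = g r \<and> measure n (T \<inter> ball y r) = h r)" for W
  define E where "E = (\<inter>) T ` {W. small W}"
  have small_subset: "small V" if "small W" "open V" "V \<subseteq> W" for V W
    using that unfolding small_def by blast
  have le: "measure m (T \<inter> V) * measure n (T \<inter> W) \<le> measure n (T \<inter> V) * measure m (T \<inter> W)"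
    if VW: "small V" "small W" for V W
  proof -
    obtain d where d: "0 < d" "\<And>y r. y \<in> T \<Longrightarrow> y \<in> V \<Longrightarrow> 0 < r \<Longrightarrow> r < d \<Longrightarrow>
        measure m (T \<inter> ball y r) = g r \<and> measure n (T \<inter> ball y r) = h r"
      using VW(1) unfolding small_def by blast
    obtain e where e: "0 < e" "\<And>y r. y \<in> T \<Longrightarrow> y \<in> W \<Longrightarrow> 0 < r \<Longrightarrow> r < e \<Longrightarrow>
        measure m (T \<inter> ball y r) = g r \<and> measure n (T \<inter> ball y r) = h r"
      using VW(2) unfolding small_def by blast
    show ?thesis
      by (rule uniform_measures_proportional_open[OF compact m n pos _ d _ e])
        (use VW in \<open>auto simp: small_def\<close>)
  qed
  obtain \<B> :: "'a set set" where \<B>: "countable \<B>" "\<And>b. b \<in> \<B> \<Longrightarrow> open b"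
    "\<And>U x. open U \<Longrightarrow> x \<in> U \<Longrightarrow> \<exists>b\<in>\<B>. x \<in> b \<and> b \<subseteq> U"
    using compact_imp_countable_base[OF compact] by metis
  have small_ex: "\<exists>d>0. small (ball x d) \<and> (\<forall>r. 0 < r \<longrightarrow> r < d \<longrightarrow> measure n (T \<inter> ball x r) = h r)"
    if "x \<in> T" for x
    using uniform[OF that] that unfolding small_def by (metis centre_in_ball open_ball)
  have cover: "T \<inter> U = (\<Union>b\<in>{b \<in> \<B>. small b \<and> b \<subseteq> U}. T \<inter> b)" if "open U" for U
  proof (intro equalityI subsetI)
    fix x assume x: "x \<in> T \<inter> U"
    then obtain d where d: "0 < d" "small (ball x d)"
      using small_ex by blast
    then obtain b where "b \<in> \<B>" "x \<in> b" "b \<subseteq> ball x d \<inter> U"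
      using \<B>(3)[of "ball x d \<inter> U" x] \<open>open U\<close> x by auto
    then show "x \<in> (\<Union>b\<in>{b \<in> \<B>. small b \<and> b \<subseteq> U}. T \<inter> b)"
      using x small_subset[OF d(2) \<B>(2)] by auto
  qed auto
  have "sigma_sets T ((\<inter>) T ` {S. open S}) = sigma_sets T E"
  proof (rule sigma_sets_eqI)
    fix X assume "X \<in> (\<inter>) T ` {S. open S}"
    then obtain U where "open U" "X = T \<inter> U"
      by auto
    then have X: "X = (\<Union>b\<in>{b \<in> \<B>. small b \<and> b \<subseteq> U}. T \<inter> b)"
      using cover by simp
    show "X \<in> sigma_sets T E"
      unfolding X
    proof (rule sigma_sets_UNION)
      show "countable ((\<lambda>b. T \<inter> b) ` {b \<in> \<B>. small b \<and> b \<subseteq> U})"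
        using \<B>(1) by (auto intro: countable_subset[of _ \<B>])
    qed (auto simp: E_def)
  next
    fix X assume "X \<in> E"
    then show "X \<in> sigma_sets T ((\<inter>) T ` {S. open S})"
      by (auto simp: E_def small_def)
  qed
  then have sets: "sets m = sigma_sets T E" "sets n = sigma_sets T E"
    by (simp_all add: m n sets_trace_borel[OF T])
  obtain x d where x: "x \<in> T" and d: "0 < d" "small (ball x d)"
      "\<And>r. 0 < r \<Longrightarrow> r < d \<Longrightarrow> measure n (T \<inter> ball x r) = h r"
    using False small_ex by blast
  define V where "V = T \<inter> ball x d"
  have "0 < h (d / 2)"
    using d pos by simp
  also have "\<dots> = measure n (T \<inter> ball x (d / 2))"
    using d by simp
  also have "\<dots> \<le> measure n V"
    unfolding V_def using subset_ball[of "d / 2" d x] d(1)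
    by (intro n.finite_measure_mono) (auto simp: n sets_restrict_space)
  finally have V: "0 < measure n V" .
  define c where "c = measure m V / measure n V"
  have c: "measure m X = c * measure n X" if X: "X \<in> E" for X
  proof -
    obtain W where W: "small W" "X = T \<inter> W"
      using X by (auto simp: E_def)
    \<comment> \<open>The inequality \<open>le\<close> is used for the two sets in both orders,
      which turns it into an equality.\<close>
    have "measure m X * measure n V = measure n X * measure m V"
      unfolding W V_def using le[OF W(1) d(2)] le[OF d(2) W(1)] by (simp add: mult.commute)
    then show ?thesis
      using V by (simp add: c_def field_simps)
  qed
  have c0: "0 \<le> c"
    by (simp add: c_def)
  have "m = scale_measure (ennreal c) n"
  proof (rule measure_eqI_generator_eq_countable[where E = E and \<Omega> = T and A = "(\<inter>) T ` {b \<in> \<B>. small b}"])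
    show "Int_stable E"
    proof (rule Int_stableI)
      fix X Y assume "X \<in> E" "Y \<in> E"
      then obtain W W' where W: "small W" "small W'" "X = T \<inter> W" "Y = T \<inter> W'"
        by (auto simp: E_def)
      then have "small (W \<inter> W')"
        by (intro small_subset[OF W(1)]) (auto simp: small_def)
      moreover have "X \<inter> Y = T \<inter> (W \<inter> W')"
        using W by auto
      ultimately show "X \<inter> Y \<in> E"
        unfolding E_def by blast
    qed
    show "emeasure m X = emeasure (scale_measure (ennreal c) n) X" if "X \<in> E" for X
      using c[OF that] c0 by (simp add: m.emeasure_eq_measure n.emeasure_eq_measure ennreal_mult)
    show "\<Union>((\<inter>) T ` {b \<in> \<B>. small b}) = T"
      using cover[of UNIV] by simp
    show "countable ((\<inter>) T ` {b \<in> \<B>. small b})"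
      using \<B>(1) by (auto intro: countable_subset[of _ \<B>])
  qed (auto simp: E_def sets)
  then have "emeasure m X = ennreal c * emeasure n X" for X
    by simp
  then have "measure m X = c * measure n X" for X
    using c0 by (simp add: measure_def enn2real_mult)
  then show ?thesis
    by simp
qed

section \<open>Compatible measures on components\<close>

lemma isometry_onto_measurable:
  assumes "isometry_onto f U V"
  shows "f \<in> restrict_space borel U \<rightarrow>\<^sub>M restrict_space borel V"
  using assms isometry_onto_continuous_on[OF assms]
  by (intro measurable_restrict_space2 borel_measurable_continuous_on_restrict)
    (auto simp: isometry_onto_def space_restrict_space)

text \<open>Pulling \<open>n\<close> back along \<open>f\<close> is encoded as pushing it forward
  under the inverse of \<open>f\<close>.\<close>

lemma emeasure_distr_isometry:
  assumes f: "isometry_onto f U V" and n: "sets n = sets (restrict_space borel V)"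
    and A: "A \<in> sets (restrict_space borel U)"
  shows "f ` A \<in> sets n" "emeasure (distr n (restrict_space borel U) (inv_into U f)) A = emeasure n (f ` A)"
proof -
  have AU: "A \<subseteq> U"
    using sets.sets_into_space[OF A] by (simp add: space_restrict_space)
  have g: "inv_into U f \<in> n \<rightarrow>\<^sub>M restrict_space borel U"
    using isometry_onto_measurable[OF isometry_onto_inv_into[OF f]] measurable_cong_sets[OF n refl] by blast
  have spn: "space n = V"
    using sets_eq_imp_space_eq[OF n] by (simp add: space_restrict_space)
  have "inv_into U f -` A \<inter> V = f ` A"
    using AU f isometry_onto_inj_on[OF f] by (auto simp: isometry_onto_def f_inv_into_f image_iff subset_iff)
  then show "f ` A \<in> sets n" "emeasure (distr n (restrict_space borel U) (inv_into U f)) A = emeasure n (f ` A)"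
    using measurable_sets[OF g A] emeasure_distr[OF g A] by (simp_all add: spn)
qed

lemma isometrically_compatibleD:
  assumes "isometrically_compatible E m" "openin (top_of_set E) U" "openin (top_of_set E) V" "isometry_onto f U V"
  shows "emeasure m U = emeasure m V"
  using assms unfolding isometrically_compatible_def by blast

lemma compatible_sets_UNIV: "isometrically_compatible UNIV \<mu> \<Longrightarrow> sets \<mu> = sets borel"
  by (simp add: isometrically_compatible_def)

lemma sets_restrict_compatible:
  assumes "isometrically_compatible UNIV \<mu>"
  shows "sets (restrict_space \<mu> U) = sets (restrict_space borel U)"
  using compatible_sets_UNIV[OF assms] by (simp add: sets_restrict_space)

text \<open>Compatibility speaks of open sets only. But every open subset of \<open>U\<close> is
  again mapped isometrically onto an open set, so the two measures agree on a generating pi-system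
  and hence on all Borel sets.\<close>

lemma compatible_distr_isometry:
  fixes \<mu> :: "'a::metric_space measure"
  assumes \<mu>: "isometrically_compatible UNIV \<mu>" "finite_measure \<mu>"
    and f: "isometry_onto f U V" "open U" "open V"
  shows "distr (restrict_space \<mu> V) (restrict_space borel U) (inv_into U f) = restrict_space \<mu> U"
    (is "?N = ?M")
proof (rule measure_eqI_generator_eq[where E = "(\<inter>) U ` {S. open S}" and \<Omega> = U and A = "\<lambda>_::nat. U"])
  interpret finite_measure \<mu> by fact
  have bor: "sets \<mu> = sets borel"
    by (rule compatible_sets_UNIV[OF \<mu>(1)])
  have sp: "space \<mu> = UNIV"
    using sets_eq_imp_space_eq[OF bor] by simp
  show "Int_stable ((\<inter>) U ` {S. open S})"
  proof (rule Int_stableI)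
    fix X Y assume "X \<in> (\<inter>) U ` {S. open S}" "Y \<in> (\<inter>) U ` {S. open S}"
    then obtain S T where "open S" "open T" "X = U \<inter> S" "Y = U \<inter> T"
      by auto
    then have "X \<inter> Y = U \<inter> (S \<inter> T)" "open (S \<inter> T)"
      by auto
    then show "X \<inter> Y \<in> (\<inter>) U ` {S. open S}"
      by blast
  qed
  show "sets ?N = sigma_sets U ((\<inter>) U ` {S. open S})"
    using f(2) by (simp add: sets_trace_borel)
  show "sets ?M = sigma_sets U ((\<inter>) U ` {S. open S})"
    using f(2) by (simp add: sets_trace_borel sets_restrict_compatible[OF \<mu>(1)])
  show "emeasure ?N X = emeasure ?M X" if "X \<in> (\<inter>) U ` {S. open S}" for X
  proof -
    have X: "open X" "X \<subseteq> U"
      using that f(2) by auto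
    then have XU: "X \<in> sets (restrict_space borel U)"
      by (auto simp: sets_restrict_space)
    have "openin (top_of_set V) (f ` X)"
      by (rule isometry_onto_openin[OF f(1)]) (use X f(2) in \<open>simp add: openin_open_eq\<close>)
    then have fX: "open (f ` X)" "f ` X \<subseteq> V"
      using f(3) by (auto simp: openin_open_eq)
    have "emeasure ?N X = emeasure (restrict_space \<mu> V) (f ` X)"
      by (rule emeasure_distr_isometry(2)[OF f(1) sets_restrict_compatible[OF \<mu>(1)] XU])
    also have "\<dots> = emeasure \<mu> (f ` X)"
      using fX f(3) by (intro emeasure_restrict_space) (auto simp: bor sp)
    also have "\<dots> = emeasure \<mu> X"
      using isometrically_compatibleD[OF \<mu>(1) _ _ isometry_onto_subset[OF f(1) X(2)]] X fX by simp
    also have "\<dots> = emeasure ?M X"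
      using X f(2) by (intro emeasure_restrict_space[symmetric]) (auto simp: bor sp)
    finally show ?thesis .
  qed
  then have "emeasure ?N U = emeasure ?M U"
    by (metis CollectI Int_UNIV_right image_eqI open_UNIV)
  also have "emeasure ?M U = emeasure \<mu> U"
    using f(2) by (intro emeasure_restrict_space) (auto simp: bor sp)
  finally show "emeasure ?N U \<noteq> \<infinity>"
    by simp
qed (auto intro: exI[of _ UNIV] simp: image_iff)

text \<open>Needed for traces of components, which are Borel but in general not open.\<close>

lemma compatible_emeasure_image:
  fixes \<mu> :: "'a::metric_space measure"
  assumes \<mu>: "isometrically_compatible UNIV \<mu>" "finite_measure \<mu>"
    and f: "isometry_onto f U V" "open U" "open V" and A: "A \<in> sets borel"
  shows "emeasure \<mu> (f ` (U \<inter> A)) = emeasure \<mu> (U \<inter> A)"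
proof -
  have bor: "sets \<mu> = sets borel"
    by (rule compatible_sets_UNIV[OF \<mu>(1)])
  have sp: "space \<mu> = UNIV"
    using sets_eq_imp_space_eq[OF bor] by simp
  have UA: "U \<inter> A \<in> sets (restrict_space borel U)"
    using A by (auto simp: sets_restrict_space)
  have "f ` (U \<inter> A) \<subseteq> V"
    using f(1) by (auto simp: isometry_onto_def)
  then have "emeasure \<mu> (f ` (U \<inter> A)) = emeasure (restrict_space \<mu> V) (f ` (U \<inter> A))"
    using f(3) by (intro emeasure_restrict_space[symmetric]) (auto simp: bor sp)
  also have "\<dots> = emeasure (restrict_space \<mu> U) (U \<inter> A)"
    using emeasure_distr_isometry(2)[OF f(1) sets_restrict_compatible[OF \<mu>(1)] UA]
      compatible_distr_isometry[OF \<mu> f] by simp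
  also have "\<dots> = emeasure \<mu> (U \<inter> A)"
    using f(2) by (intro emeasure_restrict_space) (auto simp: bor sp)
  finally show ?thesis .
qed

section \<open>Ball-invariant measures and uniqueness on a component\<close>

text \<open>A weak form of compatibility that involves only ball isometries of the whole space. It
  is shared by finite compatible measures on \<open>C\<close> and by restrictions to
  \<open>C\<close> of finite compatible measures on the whole space, and it is enough for
  proportionality; full compatibility of the restrictions is derived from it afterwards.\<close>

definition ball_invariant :: "'a::metric_space set \<Rightarrow> 'a measure \<Rightarrow> bool" where
  "ball_invariant C m \<longleftrightarrow> sets m = sets (restrict_space borel C) \<and> finite_measure m \<and>
    (\<forall>x y d r. ball_equiv d x y \<longrightarrow> x \<in> C \<longrightarrow> 0 < r \<longrightarrow> r \<le> d \<longrightarrow>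
      measure m (C \<inter> ball x r) = measure m (C \<inter> ball y r))"

text \<open>A ball isometry preserves \<open>C\<close>, so it restricts to one of the isometries
  between relatively open sets that compatibility on \<open>C\<close> speaks of.\<close>

lemma compatible_imp_ball_invariant:
  fixes C :: "'a::metric_space set"
  assumes C: "C \<in> homogeneous_components" and m: "isometrically_compatible C m" "finite_measure m"
  shows "ball_invariant C m"
proof -
  have "measure m (C \<inter> ball x r) = measure m (C \<inter> ball y r)"
    if xy: "ball_equiv d x y" "x \<in> C" "0 < r" "r \<le> d" for x y d r
  proof -
    have "ball_equiv r x y"
      using ball_equiv_mono[OF xy(1,3,4)] .
    then obtain f where f: "isometry_onto f (ball x r) (ball y r)" "f x = y"
      by (auto simp: ball_equiv_def)
    have img: "f ` (ball x r \<inter> C) = ball y r \<inter> C"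
      by (rule isometry_image_component[OF f(1) open_ball open_ball C])
    have "isometry_onto f (ball x r \<inter> C) (ball y r \<inter> C)"
      using isometry_onto_subset[OF f(1), of "ball x r \<inter> C"] by (simp add: img)
    then have "isometry_onto f (C \<inter> ball x r) (C \<inter> ball y r)"
      by (simp add: Int_commute)
    then have "emeasure m (C \<inter> ball x r) = emeasure m (C \<inter> ball y r)"
      by (intro isometrically_compatibleD[OF m(1)] openin_open_Int open_ball)
    then show ?thesis
      by (simp add: measure_def)
  qed
  then show ?thesis
    using m unfolding ball_invariant_def isometrically_compatible_def by blast
qed

text \<open>\<open>C \<inter> ball x r\<close> need not be open in the whole space, so this rests on
  the Borel form \<open>compatible_emeasure_image\<close> of invariance and not directly on the
  definition.\<close>

lemma compatible_restrict_ball_invariant: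
  fixes C :: "'a::metric_space set"
  assumes compact: "compact (UNIV :: 'a set)" and C: "C \<in> homogeneous_components"
    and \<mu>: "isometrically_compatible UNIV \<mu>" "finite_measure \<mu>"
  shows "ball_invariant C (restrict_space \<mu> C)"
proof -
  have bor: "sets \<mu> = sets borel"
    by (rule compatible_sets_UNIV[OF \<mu>(1)])
  have sp: "space \<mu> = UNIV"
    using sets_eq_imp_space_eq[OF bor] by simp
  have Cb: "C \<in> sets borel"
    by (rule component_borel[OF compact C])
  interpret finite_measure \<mu> by fact
  have "measure (restrict_space \<mu> C) (C \<inter> ball x r) = measure (restrict_space \<mu> C) (C \<inter> ball y r)"
    if xy: "ball_equiv d x y" "x \<in> C" "0 < r" "r \<le> d" for x y d r
  proof -
    have "ball_equiv r x y"
      using ball_equiv_mono[OF xy(1,3,4)] .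
    then obtain f where f: "isometry_onto f (ball x r) (ball y r)" "f x = y"
      by (auto simp: ball_equiv_def)
    have img: "f ` (ball x r \<inter> C) = ball y r \<inter> C"
      by (rule isometry_image_component[OF f(1) open_ball open_ball C])
    have "emeasure \<mu> (ball y r \<inter> C) = emeasure \<mu> (ball x r \<inter> C)"
      using compatible_emeasure_image[OF \<mu> f(1) open_ball open_ball Cb] by (simp add: img)
    then have "emeasure \<mu> (C \<inter> ball x r) = emeasure \<mu> (C \<inter> ball y r)"
      by (simp add: Int_commute)
    then show ?thesis
      by (simp add: measure_def emeasure_restrict_space bor sp Cb)
  qed
  moreover have "finite_measure (restrict_space \<mu> C)"
    using Cb by (intro finite_measure_restrict_space \<mu>(2)) (simp add: bor sp)
  ultimately show ?thesis
    unfolding ball_invariant_def using sets_restrict_compatible[OF \<mu>(1)] by blast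
qed

text \<open>If a ball around \<open>x\<close> were null, ball isometries would give every point of
  \<open>C\<close> a null neighbourhood, and countably many basic open sets would make
  \<open>C\<close> null.\<close>

lemma ball_invariant_pos:
  fixes C :: "'a::metric_space set"
  assumes compact: "compact (UNIV :: 'a set)" and C: "C \<in> homogeneous_components"
    and m: "ball_invariant C m" "measure m C \<noteq> 0" and x: "x \<in> C" and r: "0 < r"
  shows "0 < measure m (C \<inter> ball x r)"
proof (rule ccontr)
  assume "\<not> 0 < measure m (C \<inter> ball x r)"
  then have 0: "measure m (C \<inter> ball x r) = 0"
    by (simp add: zero_less_measure_iff)
  interpret finite_measure m
    using m(1) by (simp add: ball_invariant_def)
  have sets: "sets m = sets (restrict_space borel C)"
    using m(1) by (simp add: ball_invariant_def)
  have meas: "C \<inter> U \<in> sets m" if "open U" for U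
    using that by (auto simp: sets sets_restrict_space)
  obtain \<B> :: "'a set set" where \<B>: "countable \<B>" "\<And>b. b \<in> \<B> \<Longrightarrow> open b"
    "\<And>U x. open U \<Longrightarrow> x \<in> U \<Longrightarrow> \<exists>b\<in>\<B>. x \<in> b \<and> b \<subseteq> U"
    using compact_imp_countable_base[OF compact] by metis
  have "\<exists>b\<in>\<B>. y \<in> b \<and> C \<inter> b \<in> null_sets m" if y: "y \<in> C" for y
  proof -
    obtain e where e: "0 < e" "ball_equiv e x y"
      using component_mem_iff[OF C x] y by blast
    define s where "s = min e r"
    have s: "0 < s" "s \<le> e" "s \<le> r"
      using e r by (auto simp: s_def)
    obtain b where b: "b \<in> \<B>" "y \<in> b" "b \<subseteq> ball y s"
      using \<B>(3)[of "ball y s" y] s by auto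
    have "measure m (C \<inter> b) \<le> measure m (C \<inter> ball y s)"
      using b by (intro finite_measure_mono meas) auto
    also have "\<dots> = measure m (C \<inter> ball x s)"
      using m(1) e x s unfolding ball_invariant_def by metis
    also have "\<dots> \<le> measure m (C \<inter> ball x r)"
      using s by (intro finite_measure_mono meas) auto
    finally have "measure m (C \<inter> b) = 0"
      using 0 measure_nonneg[of m "C \<inter> b"] by simp
    then have "C \<inter> b \<in> null_sets m"
      using meas[OF \<B>(2)[OF b(1)]] by (auto simp: emeasure_eq_measure)
    then show ?thesis
      using b by blast
  qed
  then have "C = (\<Union>b\<in>{b \<in> \<B>. C \<inter> b \<in> null_sets m}. C \<inter> b)"
    by blast
  moreover have "(\<Union>b\<in>{b \<in> \<B>. C \<inter> b \<in> null_sets m}. C \<inter> b) \<in> null_sets m"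
    using \<B>(1) by (intro null_sets_UN') (auto intro: countable_subset[of _ \<B>])
  ultimately have "emeasure m C = 0"
    by auto
  then show False
    using m(2) by (simp add: measure_def)
qed

text \<open>With the reference point \<open>x0\<close> fixed, the measure of small balls near any
  \<open>x\<close> is one and the same function of the radius, as
  \<open>uniform_measures_proportional\<close> demands.\<close>

lemma component_uniform_nbhd:
  fixes C :: "'a::metric_space set"
  assumes compact: "compact (UNIV :: 'a set)" and countable: "countable (homogeneous_components :: 'a set set)"
    and C: "C \<in> homogeneous_components" and x0: "x0 \<in> C" and x: "x \<in> C"
  obtains d where "0 < d" "\<And>y. y \<in> C \<Longrightarrow> y \<in> ball x d \<Longrightarrow> ball_equiv d x0 y"
proof -
  obtain d where d: "0 < d" "\<And>y. y \<in> C \<Longrightarrow> y \<in> ball x d \<Longrightarrow> ball_equiv d x y"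
    using component_locally_uniform[OF compact countable C x] by metis
  obtain e where e: "0 < e" "ball_equiv e x0 x"
    using component_mem_iff[OF C x0] x by blast
  define r where "r = min d e"
  have r: "0 < r" "r \<le> d" "r \<le> e"
    using d e by (auto simp: r_def)
  have "ball_equiv r x0 y" if "y \<in> C" "y \<in> ball x r" for y
  proof (rule ball_equiv_trans)
    show "ball_equiv r x0 x"
      by (rule ball_equiv_mono[OF e(2) r(1,3)])
    have "ball_equiv d x y"
      using that r by (intro d) auto
    then show "ball_equiv r x y"
      by (rule ball_equiv_mono[OF _ r(1,2)])
  qed
  then show ?thesis
    using r(1) that by blast
qed

lemma ball_invariant_proportional:
  fixes C :: "'a::metric_space set"
  assumes compact: "compact (UNIV :: 'a set)" and countable: "countable (homogeneous_components :: 'a set set)"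
    and C: "C \<in> homogeneous_components"
    and m: "ball_invariant C m" "measure m C \<noteq> 0" and n: "ball_invariant C n" "measure n C \<noteq> 0"
    and A: "A \<in> sets m" and B: "B \<in> sets m"
  shows "measure m A * measure n B = measure n A * measure m B"
proof -
  obtain x0 where x0: "x0 \<in> C"
    using component_nonempty[OF C] by blast
  have unif: "\<exists>d>0. \<forall>y r. y \<in> C \<longrightarrow> y \<in> ball x d \<longrightarrow> 0 < r \<longrightarrow> r < d \<longrightarrow>
      measure m (C \<inter> ball y r) = measure m (C \<inter> ball x0 r) \<and>
      measure n (C \<inter> ball y r) = measure n (C \<inter> ball x0 r)" if x: "x \<in> C" for x
  proof -
    obtain d where d: "0 < d" "\<And>y. y \<in> C \<Longrightarrow> y \<in> ball x d \<Longrightarrow> ball_equiv d x0 y"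
      using component_uniform_nbhd[OF compact countable C x0 x] by metis
    have "measure p (C \<inter> ball y r) = measure p (C \<inter> ball x0 r)"
      if "ball_invariant C p" "y \<in> C" "y \<in> ball x d" "0 < r" "r < d" for p y r
      using that(1) d(2)[OF that(2,3)] x0 that(4,5) unfolding ball_invariant_def by simp
    then show ?thesis
      using d(1) m(1) n(1) by blast
  qed
  show ?thesis
  proof (rule uniform_measures_proportional[OF compact _ _ _ _ _ _ component_borel[OF compact C] unif A B])
    show "0 < measure m (C \<inter> ball x0 r)" "0 < measure n (C \<inter> ball x0 r)" if "0 < r" for r
      using ball_invariant_pos[OF compact C m x0 that] ball_invariant_pos[OF compact C n x0 that] by auto
  qed (use m(1) n(1) in \<open>auto simp: ball_invariant_def\<close>)
qed

lemma ball_invariant_prob_unique: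
  fixes C :: "'a::metric_space set"
  assumes compact: "compact (UNIV :: 'a set)" and countable: "countable (homogeneous_components :: 'a set set)"
    and C: "C \<in> homogeneous_components"
    and m: "ball_invariant C m" "prob_space m" and n: "ball_invariant C n" "prob_space n"
  shows "m = n"
proof (rule measure_eqI)
  interpret m: prob_space m by fact
  interpret n: prob_space n by fact
  have sets: "sets m = sets (restrict_space borel C)" "sets n = sets (restrict_space borel C)"
    using m n by (auto simp: ball_invariant_def)
  then show "sets m = sets n"
    by simp
  have "space m = C" "space n = C"
    using sets_eq_imp_space_eq[OF sets(1)] sets_eq_imp_space_eq[OF sets(2)] by (simp_all add: space_restrict_space)
  then have 1: "measure m C = 1" "measure n C = 1" "C \<in> sets m"
    using m.prob_space n.prob_space sets.top[of m] by simp_all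
  show "emeasure m A = emeasure n A" if "A \<in> sets m" for A
    using ball_invariant_proportional[OF compact countable C m(1) _ n(1) _ that 1(3)] 1
    by (simp add: m.emeasure_eq_measure n.emeasure_eq_measure)
qed

section \<open>Restricting a compatible measure to a component\<close>

text \<open>For \<open>y \<in> U\<close> and small \<open>r\<close>, both
  \<open>U \<inter> ball y r\<close> and its image under \<open>f\<close> are traces on
  \<open>C\<close> of balls centred in \<open>C\<close>. Their measures agree by ball isometries of
  the whole space that are unrelated to \<open>f\<close>. So \<open>\<mu>\<close> on
  \<open>U\<close> and its pullback from \<open>V\<close> give small balls the same measure, and
  this forces equal total mass.\<close>

lemma compatible_restrict_component:
  fixes C :: "'a::metric_space set"
  assumes compact: "compact (UNIV :: 'a set)" and countable: "countable (homogeneous_components :: 'a set set)"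
    and C: "C \<in> homogeneous_components"
    and \<mu>: "isometrically_compatible UNIV \<mu>" "finite_measure \<mu>"
  shows "isometrically_compatible C (restrict_space \<mu> C)"
  unfolding isometrically_compatible_def
proof (intro conjI allI impI)
  interpret finite_measure \<mu> by fact
  have bor: "sets \<mu> = sets borel"
    by (rule compatible_sets_UNIV[OF \<mu>(1)])
  have sp: "space \<mu> = UNIV"
    using sets_eq_imp_space_eq[OF bor] by simp
  have Cb: "C \<in> sets borel"
    by (rule component_borel[OF compact C])
  show "sets (restrict_space \<mu> C) = sets (restrict_space borel C)"
    by (rule sets_restrict_compatible[OF \<mu>(1)])
  fix U V f
  assume "openin (top_of_set C) U \<and> openin (top_of_set C) V \<and> isometry_onto f U V"
  then have UV: "openin (top_of_set C) U" "openin (top_of_set C) V" and f: "isometry_onto f U V"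
    by auto
  obtain S T where S: "open S" "U = C \<inter> S" and T: "open T" "V = C \<inter> T"
    using UV by (auto simp: openin_open)
  have Ub: "U \<in> sets borel" and Vb: "V \<in> sets borel"
    using S T Cb by auto
  have rC: "emeasure (restrict_space \<mu> C) X = emeasure \<mu> X" if "X \<subseteq> C" for X
    using that Cb by (simp add: emeasure_restrict_space bor sp)
  have "emeasure \<mu> U = emeasure \<mu> V"
  \<comment> \<open>In the degenerate cases both sides vanish; otherwise all traces of balls have
    positive measure, as the proportionality lemma requires.\<close>
  proof (cases "measure \<mu> C = 0 \<or> U = {}")
    case True
    moreover have "measure \<mu> U \<le> measure \<mu> C" "measure \<mu> V \<le> measure \<mu> C"
      using S T Cb by (auto intro!: finite_measure_mono simp: bor)
    moreover have "U = {} \<longleftrightarrow> V = {}"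
      using f by (auto simp: isometry_onto_def)
    ultimately show ?thesis
      by (auto simp: emeasure_eq_measure measure_le_0_iff)
  next
    case False
    then obtain x0 where x0: "x0 \<in> U"
      by blast
    then have x0C: "x0 \<in> C"
      using S by blast
    define g where "g r = measure \<mu> (C \<inter> ball x0 r)" for r
    have inv: "ball_invariant C (restrict_space \<mu> C)"
      by (rule compatible_restrict_ball_invariant[OF compact C \<mu>])
    have mC: "measure (restrict_space \<mu> C) X = measure \<mu> X" if "X \<subseteq> C" for X
      using rC[OF that] by (simp add: measure_def)
    have pos: "0 < g r" if "0 < r" for r
      using ball_invariant_pos[OF compact C inv _ x0C that] False by (simp add: g_def mC)
    have gball: "measure \<mu> (C \<inter> ball y r) = g r" if "ball_equiv d x0 y" "0 < r" "r \<le> d" for y d r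
    proof -
      have "measure (restrict_space \<mu> C) (C \<inter> ball x0 r) = measure (restrict_space \<mu> C) (C \<inter> ball y r)"
        using inv that x0C unfolding ball_invariant_def by blast
      then show ?thesis
        by (simp add: mC g_def)
    qed
    define m where "m = restrict_space \<mu> U"
    define n where "n = distr (restrict_space \<mu> V) (restrict_space borel U) (inv_into U f)"
    have sets: "sets m = sets (restrict_space borel U)" "sets n = sets (restrict_space borel U)"
      unfolding m_def n_def by (simp_all add: sets_restrict_compatible[OF \<mu>(1)])
    have fin: "finite_measure m"
      unfolding m_def using Ub by (intro finite_measure_restrict_space \<mu>(2)) (simp add: bor sp)
    have em: "measure m X = measure \<mu> X" if "X \<subseteq> U" for X
      using that Ub by (simp add: measure_def m_def emeasure_restrict_space bor sp)
    have en: "emeasure n X = emeasure \<mu> (f ` X)" if "X \<in> sets (restrict_space borel U)" for X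
    proof -
      have "X \<subseteq> U"
        using sets.sets_into_space[OF that] by (simp add: space_restrict_space)
      then have "f ` X \<subseteq> V"
        using f by (auto simp: isometry_onto_def)
      then show ?thesis
        using emeasure_distr_isometry(2)[OF f sets_restrict_compatible[OF \<mu>(1)] that] Vb
        by (simp add: n_def emeasure_restrict_space bor sp)
    qed
    have topU: "U \<in> sets (restrict_space borel U)"
      by (auto simp: sets_restrict_space)
    have fU: "f ` U = V"
      using f by (simp add: isometry_onto_def)
    have spn: "space n = U"
      by (simp add: n_def space_restrict_space)
    have finn: "finite_measure n"
      using en[OF topU] by (intro finite_measureI) (simp add: spn)
    have unif: "\<exists>d>0. \<forall>y r. y \<in> U \<longrightarrow> y \<in> ball x d \<longrightarrow> 0 < r \<longrightarrow> r < d \<longrightarrow>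
      measure m (U \<inter> ball y r) = g r \<and> measure n (U \<inter> ball y r) = g r" if x: "x \<in> U" for x
    proof -
      have xC: "x \<in> C" "x \<in> S" and fxC: "f x \<in> C" "f x \<in> T"
        using x fU S T by auto
      obtain d1 where d1: "0 < d1" "\<And>y. y \<in> C \<Longrightarrow> y \<in> ball x d1 \<Longrightarrow> ball_equiv d1 x0 y"
        using component_uniform_nbhd[OF compact countable C x0C xC(1)] by metis
      obtain d2 where d2: "0 < d2" "\<And>y. y \<in> C \<Longrightarrow> y \<in> ball (f x) d2 \<Longrightarrow> ball_equiv d2 x0 y"
        using component_uniform_nbhd[OF compact countable C x0C fxC(1)] by metis
      obtain d3 where d3: "0 < d3" "ball x d3 \<subseteq> S"
        using openE[OF S(1) xC(2)] by blast
      obtain d4 where d4: "0 < d4" "ball (f x) d4 \<subseteq> T"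
        using openE[OF T(1) fxC(2)] by blast
      \<comment> \<open>\<open>d1\<close> and \<open>d2\<close> provide the ball isometries near
        \<open>x\<close> and \<open>f x\<close>. Half of \<open>d3\<close> and \<open>d4\<close>
        keeps balls of radius below \<open>d\<close> around nearby points inside \<open>S\<close>
        and \<open>T\<close>, where traces on \<open>U\<close> or \<open>V\<close> coincide with
        traces on \<open>C\<close>.\<close>
      define d where "d = min (min d1 d2) (min d3 d4) / 2"
      have d: "0 < d" "d \<le> d1" "d \<le> d2" "2 * d \<le> d3" "2 * d \<le> d4"
        using d1(1) d2(1) d3(1) d4(1) by (auto simp: d_def)
      have double: "ball w r \<subseteq> ball z e" if "w \<in> ball z d" "r < d" "2 * d \<le> e" for w z :: 'a and r e
      proof
        fix t assume "t \<in> ball w r"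
        then show "t \<in> ball z e"
          using that dist_triangle[of z t w] by simp
      qed
      have "measure m (U \<inter> ball y r) = g r \<and> measure n (U \<inter> ball y r) = g r"
        if y: "y \<in> U" "y \<in> ball x d" and r: "0 < r" "r < d" for y r
      proof
        have "measure m (U \<inter> ball y r) = measure \<mu> (U \<inter> ball y r)"
          by (rule em) simp
        moreover have "U \<inter> ball y r = C \<inter> ball y r"
          using double[OF y(2) r(2) d(4)] d3 S by blast
        moreover have "ball_equiv d1 x0 y"
          using y d S by (intro d1) auto
        ultimately show "measure m (U \<inter> ball y r) = g r"
          using gball[of d1 y r] r d by simp
        have "dist (f x) (f y) = dist x y"
          using f x y by (simp add: isometry_onto_def)
        then have fy: "f y \<in> ball (f x) d" "f y \<in> C"
          using y fU T by auto
        have "f ` (U \<inter> ball y r) = V \<inter> ball (f y) r"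
          by (rule isometry_onto_image_ball[OF f y(1)])
        also have "\<dots> = C \<inter> ball (f y) r"
          using double[OF fy(1) r(2) d(5)] d4 T by blast
        finally have "measure n (U \<inter> ball y r) = measure \<mu> (C \<inter> ball (f y) r)"
          using en[of "U \<inter> ball y r"] by (simp add: measure_def sets_restrict_space)
        moreover have "ball_equiv d2 x0 (f y)"
          using fy d by (intro d2) auto
        ultimately show "measure n (U \<inter> ball y r) = g r"
          using gball[of d2 "f y" r] r d by simp
      qed
      then show ?thesis
        using d(1) by blast
    qed
    obtain d where d: "0 < d" "\<And>y r. y \<in> U \<Longrightarrow> y \<in> ball x0 d \<Longrightarrow> 0 < r \<Longrightarrow> r < d \<Longrightarrow>
      measure m (U \<inter> ball y r) = g r \<and> measure n (U \<inter> ball y r) = g r"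
      using unif[OF x0] by blast
    have B: "U \<inter> ball x0 (d / 2) \<in> sets m"
      by (auto simp: sets sets_restrict_space)
    \<comment> \<open>Proportionality leaves a constant open; the common measure
      \<open>g (d / 2)\<close> of a small ball shows that it is 1.\<close>
    have "measure m U * measure n (U \<inter> ball x0 (d / 2)) = measure n U * measure m (U \<inter> ball x0 (d / 2))"
      by (rule uniform_measures_proportional[OF compact sets(1) fin sets(2) finn pos pos Ub unif _ B])
        (simp_all add: topU sets)
    then have "measure m U = measure n U"
      using d(2)[OF x0, of "d / 2"] d(1) pos[of "d / 2"] by simp
    moreover have "measure m U = measure \<mu> U"
      by (rule em) simp
    moreover have "measure n U = measure \<mu> V"
      using en[OF topU] by (simp add: measure_def fU)
    ultimately show ?thesis
      by (simp add: emeasure_eq_measure)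
  qed
  then show "emeasure (restrict_space \<mu> C) U = emeasure (restrict_space \<mu> C) V"
    using S T by (simp add: rC)
qed

lemma compatible_scale:
  "isometrically_compatible E m \<Longrightarrow> isometrically_compatible E (scale_measure c m)"
  unfolding isometrically_compatible_def by (metis emeasure_scale_measure sets_scale_measure)

lemma admissible_component_prob:
  fixes C :: "'a::metric_space set"
  assumes compact: "compact (UNIV :: 'a set)" and countable: "countable (homogeneous_components :: 'a set set)"
    and C: "C \<in> admissible_components"
  shows "\<exists>!m. isometrically_compatible_prob C m"
proof -
  have Cc: "C \<in> homogeneous_components"
    using C by (simp add: admissible_components_def)
  obtain m where m: "isometrically_compatible C m" "finite_measure m" "emeasure m (space m) \<noteq> 0"
    using C by (auto simp: admissible_components_def)
  interpret finite_measure m by fact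
  define c where "c = 1 / measure m (space m)"
  have "measure m (space m) \<noteq> 0"
    using m(3) by (simp add: emeasure_eq_measure)
  then have "ennreal c * emeasure m (space m) = 1"
    by (simp add: c_def emeasure_eq_measure ennreal_mult'[symmetric])
  then have "isometrically_compatible_prob C (scale_measure (ennreal c) m)"
    unfolding isometrically_compatible_prob_def
    by (intro conjI compatible_scale m prob_spaceI) (simp add: space_scale_measure)
  moreover have "p = q" if "isometrically_compatible_prob C p" "isometrically_compatible_prob C q" for p q
    using that unfolding isometrically_compatible_prob_def
    by (intro ball_invariant_prob_unique[OF compact countable Cc] compatible_imp_ball_invariant[OF Cc])
      (auto simp: prob_space.finite_measure)
  ultimately show ?thesis
    by blast
qed

section \<open>Decomposition, mixtures and extreme points\<close>

lemma isometrically_compatible_UNIV_iff: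
  "isometrically_compatible UNIV \<mu> \<longleftrightarrow> sets \<mu> = sets borel \<and>
    (\<forall>U V f. open U \<longrightarrow> open V \<longrightarrow> isometry_onto f U V \<longrightarrow> emeasure \<mu> U = emeasure \<mu> V)"
proof -
  have "sets (restrict_space borel (UNIV :: 'a set)) = sets borel"
    by (simp add: sets_restrict_space)
  then show ?thesis
    unfolding isometrically_compatible_def by auto
qed

text \<open>In \<open>ennreal\<close> the unordered sum is the supremum of the finite partial sums,
  so it suffices to exhaust \<open>F\<close> by an increasing sequence of finite
  subfamilies.\<close>

lemma emeasure_countable_partition:
  assumes F: "countable F" "F \<subseteq> sets M" "pairwise disjnt F" and B: "B \<in> sets M" "B \<subseteq> \<Union>F"
  shows "emeasure M B = (\<Sum>\<^sub>\<infinity>C\<in>F. emeasure M (B \<inter> C))"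
proof -
  have fin: "sum (\<lambda>C. emeasure M (B \<inter> C)) G = emeasure M (\<Union>C\<in>G. B \<inter> C)"
    if "finite G" "G \<subseteq> F" for G
  proof (rule sum_emeasure)
    show "disjoint_family_on (\<lambda>C. B \<inter> C) G"
      using F(3) that unfolding disjoint_family_on_def pairwise_def disjnt_def by blast
  qed (use that F B in auto)
  have "emeasure M B = (SUP G\<in>{G. finite G \<and> G \<subseteq> F}. sum (\<lambda>C. emeasure M (B \<inter> C)) G)"
  proof (rule antisym)
    show "(SUP G\<in>{G. finite G \<and> G \<subseteq> F}. sum (\<lambda>C. emeasure M (B \<inter> C)) G) \<le> emeasure M B"
      using B by (intro SUP_least) (auto simp: fin intro!: emeasure_mono)
    show "emeasure M B \<le> (SUP G\<in>{G. finite G \<and> G \<subseteq> F}. sum (\<lambda>C. emeasure M (B \<inter> C)) G)"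
    proof (cases "F = {}")
      case True
      then show ?thesis
        using B by simp
    next
      case False
      \<comment> \<open>If \<open>F\<close> is finite, \<open>from_nat_into\<close> repeats values;
        \<open>G k\<close> is a set, so nothing is counted twice.\<close>
      define G where "G k = from_nat_into F ` {..<k}" for k :: nat
      have G: "finite (G k)" "G k \<subseteq> F" for k
        unfolding G_def using from_nat_into[OF False] by auto
      define A where "A k = (\<Union>C\<in>G k. B \<inter> C)" for k
      have "A k \<in> sets M" for k
        unfolding A_def using G(2)[of k] F(2) B(1) by (intro sets.finite_UN[OF G(1)] sets.Int) auto
      then have "range A \<subseteq> sets M"
        by blast
      moreover have "incseq A"
        unfolding incseq_def A_def G_def by fastforce
      ultimately have "(SUP k. emeasure M (A k)) = emeasure M (\<Union>k. A k)"
        by (rule SUP_emeasure_incseq)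
      moreover have "(\<Union>k. A k) = B"
      proof (intro equalityI subsetI)
        fix x assume x: "x \<in> B"
        then obtain C where C: "C \<in> F" "x \<in> C"
          using B by blast
        then obtain k where "from_nat_into F k = C"
          using from_nat_into_surj[OF F(1)] by blast
        then have "C \<in> G (Suc k)"
          unfolding G_def by blast
        then show "x \<in> (\<Union>k. A k)"
          using x C unfolding A_def by blast
      qed (auto simp: A_def)
      ultimately have "emeasure M B = (SUP k. emeasure M (A k))"
        by simp
      also have "\<dots> \<le> (SUP G\<in>{G. finite G \<and> G \<subseteq> F}. sum (\<lambda>C. emeasure M (B \<inter> C)) G)"
      proof (rule SUP_least)
        fix k
        show "emeasure M (A k) \<le> (SUP G\<in>{G. finite G \<and> G \<subseteq> F}. sum (\<lambda>C. emeasure M (B \<inter> C)) G)"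
          unfolding A_def fin[OF G, symmetric] using G by (intro SUP_upper) simp
      qed
      finally show ?thesis .
    qed
  qed
  then show ?thesis
    by (simp add: nonneg_infsum_complete)
qed

text \<open>The weights are real, while measures decompose into sums in \<open>ennreal\<close>,
  where every family is summable. In the way back, finiteness of the \<open>ennreal\<close> sum
  bounds the partial sums and yields real summability.\<close>

lemma has_sum_iff_infsum_ennreal:
  fixes l :: "'a \<Rightarrow> real"
  assumes l: "\<And>x. x \<in> A \<Longrightarrow> 0 \<le> l x" and s: "0 \<le> s"
  shows "(l has_sum s) A \<longleftrightarrow> (\<Sum>\<^sub>\<infinity>x\<in>A. ennreal (l x)) = ennreal s"
proof -
  have sum: "(\<Sum>x\<in>F. ennreal (l x)) = ennreal (sum l F)" if "F \<subseteq> A" for F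
    using that l by (intro sum_ennreal) auto
  have inf: "(\<Sum>\<^sub>\<infinity>x\<in>A. ennreal (l x)) = (SUP F\<in>{F. finite F \<and> F \<subseteq> A}. ennreal (sum l F))"
    by (subst nonneg_infsum_complete) (auto intro!: SUP_cong simp: sum)
  have summ: "(\<Sum>\<^sub>\<infinity>x\<in>A. ennreal (l x)) = ennreal (infsum l A)" if "l summable_on A"
    using infsum_nonneg_is_SUPREMUM_ennreal[OF that l] by (simp add: inf)
  show ?thesis
  proof
    assume "(l has_sum s) A"
    then show "(\<Sum>\<^sub>\<infinity>x\<in>A. ennreal (l x)) = ennreal s"
      using summ by (simp add: has_sum_imp_summable infsumI)
  next
    assume eq: "(\<Sum>\<^sub>\<infinity>x\<in>A. ennreal (l x)) = ennreal s"
    have "sum l F \<le> s" if "finite F" "F \<subseteq> A" for F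
    proof -
      have "ennreal (sum l F) \<le> ennreal s"
        unfolding eq[symmetric] inf using that by (intro SUP_upper) simp
      then show ?thesis
        using s by simp
    qed
    then have summable: "l summable_on A"
      using l by (intro nonneg_bdd_above_summable_on) (auto intro!: bdd_aboveI[of _ s])
    then have "infsum l A = s"
      using summ eq s infsum_nonneg[of A l] l by simp
    then show "(l has_sum s) A"
      using summable by (simp add: has_sum_iff)
  qed
qed

lemma components_measurable:
  assumes "compact (UNIV :: 'a::metric_space set)" "sets \<mu> = sets borel"
  shows "(homogeneous_components :: 'a set set) \<subseteq> sets \<mu>"
  using component_borel[OF assms(1)] assms(2) by auto

lemma components_pairwise_disjnt: "pairwise disjnt homogeneous_components"
  using components_disjoint by (auto simp: pairwise_def disjnt_def)

lemma component_prob_compatible: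
  fixes C :: "'a::metric_space set"
  assumes "compact (UNIV :: 'a set)" "countable (homogeneous_components :: 'a set set)"
    and "C \<in> admissible_components"
  shows "isometrically_compatible_prob C (component_prob C)"
  unfolding component_prob_def by (rule theI'[OF admissible_component_prob[OF assms]])

lemma component_prob_eqI:
  fixes C :: "'a::metric_space set"
  assumes "compact (UNIV :: 'a set)" "countable (homogeneous_components :: 'a set set)"
    and "C \<in> admissible_components" "isometrically_compatible_prob C m"
  shows "component_prob C = m"
  unfolding component_prob_def by (rule the1_equality[OF admissible_component_prob[OF assms(1-3)] assms(4)])

lemma compatible_prob_imp_admissible:
  assumes "C \<in> homogeneous_components" "isometrically_compatible_prob C m"
  shows "C \<in> admissible_components"
proof -
  interpret prob_space m
    using assms(2) by (simp add: isometrically_compatible_prob_def)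
  have "emeasure m (space m) \<noteq> 0"
    by (simp add: emeasure_space_1)
  then show ?thesis
    using assms finite_measure_axioms
    by (auto simp: admissible_components_def isometrically_compatible_prob_def)
qed

lemma compatible_restrict_component_prob:
  fixes C :: "'a::metric_space set"
  assumes compact: "compact (UNIV :: 'a set)" and countable: "countable (homogeneous_components :: 'a set set)"
    and C: "C \<in> homogeneous_components"
    and \<mu>: "isometrically_compatible_prob UNIV \<mu>" and pos: "measure \<mu> C \<noteq> 0"
  shows "isometrically_compatible_prob C (scale_measure (ennreal (1 / measure \<mu> C)) (restrict_space \<mu> C))"
proof -
  interpret prob_space \<mu>
    using \<mu> by (simp add: isometrically_compatible_prob_def)
  have comp: "isometrically_compatible UNIV \<mu>"
    using \<mu> by (simp add: isometrically_compatible_prob_def)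
  have bor: "sets \<mu> = sets borel"
    by (rule compatible_sets_UNIV[OF comp])
  have sp: "space \<mu> = UNIV"
    using sets_eq_imp_space_eq[OF bor] by simp
  have Cb: "C \<in> sets borel"
    by (rule component_borel[OF compact C])
  have "ennreal (1 / measure \<mu> C) * emeasure (restrict_space \<mu> C) C = 1"
    using pos Cb by (simp add: emeasure_restrict_space bor sp emeasure_eq_measure ennreal_mult'[symmetric])
  then show ?thesis
    unfolding isometrically_compatible_prob_def
    by (intro conjI compatible_scale compatible_restrict_component[OF compact countable C comp] finite_measure_axioms prob_spaceI)
      (simp add: space_scale_measure space_restrict_space sp)
qed

text \<open>The normalised restriction of \<open>\<mu>\<close> is a compatible probability on
  \<open>C\<close>; its existence makes \<open>C\<close> admissible, and uniqueness identifies it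
  with \<open>component_prob C\<close>.\<close>

lemma compatible_prob_on_component:
  fixes C :: "'a::metric_space set"
  assumes compact: "compact (UNIV :: 'a set)" and countable: "countable (homogeneous_components :: 'a set set)"
    and C: "C \<in> homogeneous_components"
    and \<mu>: "isometrically_compatible_prob UNIV \<mu>" and pos: "measure \<mu> C \<noteq> 0" and B: "B \<in> sets borel"
  shows "C \<in> admissible_components"
    "emeasure \<mu> (B \<inter> C) = ennreal (measure \<mu> C) * emeasure (component_prob C) (B \<inter> C)"
proof -
  note p = compatible_restrict_component_prob[OF compact countable C \<mu> pos]
  show adm: "C \<in> admissible_components"
    by (rule compatible_prob_imp_admissible[OF C p])
  interpret prob_space \<mu>
    using \<mu> by (simp add: isometrically_compatible_prob_def)
  have bor: "sets \<mu> = sets borel"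
    using \<mu> by (intro compatible_sets_UNIV) (simp add: isometrically_compatible_prob_def)
  have sp: "space \<mu> = UNIV"
    using sets_eq_imp_space_eq[OF bor] by simp
  have Cb: "C \<in> sets borel"
    by (rule component_borel[OF compact C])
  have "emeasure (component_prob C) (B \<inter> C) = ennreal (1 / measure \<mu> C) * emeasure \<mu> (B \<inter> C)"
    using Cb by (simp add: component_prob_eqI[OF compact countable adm p] emeasure_restrict_space bor sp)
  then show "emeasure \<mu> (B \<inter> C) = ennreal (measure \<mu> C) * emeasure (component_prob C) (B \<inter> C)"
    using pos by (simp add: emeasure_eq_measure ennreal_mult'[symmetric])
qed

text \<open>The weight of \<open>C\<close> is \<open>measure \<mu> C\<close>.\<close>

lemma compatible_prob_iff:
  fixes \<mu> :: "'a::metric_space measure"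
  assumes compact: "compact (UNIV :: 'a set)" and countable: "countable (homogeneous_components :: 'a set set)"
  shows "isometrically_compatible_prob UNIV \<mu> \<longleftrightarrow>
    (\<exists>l :: 'a set \<Rightarrow> real.
       (\<forall>C \<in> admissible_components. 0 \<le> l C) \<and>
       (l has_sum 1) admissible_components \<and>
       sets \<mu> = sets borel \<and>
       (\<forall>B \<in> sets borel. emeasure \<mu> B =
          (\<Sum>\<^sub>\<infinity>C\<in>admissible_components. ennreal (l C) * emeasure (component_prob C) (B \<inter> C))))"
proof
  assume \<mu>: "isometrically_compatible_prob UNIV \<mu>"
  interpret prob_space \<mu>
    using \<mu> by (simp add: isometrically_compatible_prob_def)
  have bor: "sets \<mu> = sets borel"
    using \<mu> by (intro compatible_sets_UNIV) (simp add: isometrically_compatible_prob_def)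
  have sp: "space \<mu> = UNIV"
    using sets_eq_imp_space_eq[OF bor] by simp
  have adm: "C \<in> homogeneous_components" if "C \<in> admissible_components" for C :: "'a set"
    using that by (simp add: admissible_components_def)
  have zero: "emeasure \<mu> (B \<inter> C) = 0"
    if "C \<in> homogeneous_components" "measure \<mu> C = 0" for B C
  proof -
    have "emeasure \<mu> (B \<inter> C) \<le> emeasure \<mu> C"
      using component_borel[OF compact that(1)] by (intro emeasure_mono) (simp_all add: bor)
    also have "emeasure \<mu> C = 0"
      using that(2) by (simp add: emeasure_eq_measure)
    finally show ?thesis
      by simp
  qed
  have eq: "emeasure \<mu> (B \<inter> C) = ennreal (measure \<mu> C) * emeasure (component_prob C) (B \<inter> C)"
    if "C \<in> admissible_components" "B \<in> sets borel" for B C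
    using compatible_prob_on_component(2)[OF compact countable adm \<mu> _ that(2)] zero[OF adm] that(1)
    by (cases "measure \<mu> C = 0") auto
  have decomp: "emeasure \<mu> B = (\<Sum>\<^sub>\<infinity>C\<in>admissible_components. emeasure \<mu> (B \<inter> C))" if "B \<in> sets borel" for B
  proof -
    have "emeasure \<mu> B = (\<Sum>\<^sub>\<infinity>C\<in>homogeneous_components. emeasure \<mu> (B \<inter> C))"
      by (rule emeasure_countable_partition[OF countable components_measurable[OF compact bor] components_pairwise_disjnt])
        (use that in \<open>auto simp: bor Union_components\<close>)
    \<comment> \<open>Components that are not admissible carry no mass and drop out of the
      sum.\<close>
    also have "\<dots> = (\<Sum>\<^sub>\<infinity>C\<in>admissible_components. emeasure \<mu> (B \<inter> C))"
    proof (rule infsum_cong_neutral)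
      fix C assume C: "C \<in> homogeneous_components - (admissible_components :: 'a set set)"
      then have "measure \<mu> C = 0"
        using compatible_prob_on_component(1)[OF compact countable _ \<mu> _ that] by blast
      then show "emeasure \<mu> (B \<inter> C) = 0"
        using zero C by blast
    qed (use adm in auto)
    finally show ?thesis .
  qed
  have "(\<Sum>\<^sub>\<infinity>C\<in>admissible_components. ennreal (measure \<mu> C)) = 1"
    using decomp[of UNIV] emeasure_space_1 by (simp add: sp emeasure_eq_measure)
  then have "(measure \<mu> has_sum 1) admissible_components"
    by (subst has_sum_iff_infsum_ennreal) auto
  moreover have "emeasure \<mu> B = (\<Sum>\<^sub>\<infinity>C\<in>admissible_components. ennreal (measure \<mu> C) * emeasure (component_prob C) (B \<inter> C))"
    if "B \<in> sets borel" for B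
    unfolding decomp[OF that] by (rule infsum_cong) (rule eq[OF _ that])
  ultimately show "\<exists>l :: 'a set \<Rightarrow> real.
       (\<forall>C \<in> admissible_components. 0 \<le> l C) \<and>
       (l has_sum 1) admissible_components \<and>
       sets \<mu> = sets borel \<and>
       (\<forall>B \<in> sets borel. emeasure \<mu> B =
          (\<Sum>\<^sub>\<infinity>C\<in>admissible_components. ennreal (l C) * emeasure (component_prob C) (B \<inter> C)))"
    using bor by (intro exI[of _ "measure \<mu>"]) auto
next
  assume "\<exists>l :: 'a set \<Rightarrow> real.
       (\<forall>C \<in> admissible_components. 0 \<le> l C) \<and>
       (l has_sum 1) admissible_components \<and>
       sets \<mu> = sets borel \<and>
       (\<forall>B \<in> sets borel. emeasure \<mu> B =
          (\<Sum>\<^sub>\<infinity>C\<in>admissible_components. ennreal (l C) * emeasure (component_prob C) (B \<inter> C)))"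
  then obtain l :: "'a set \<Rightarrow> real" where l: "\<And>C. C \<in> admissible_components \<Longrightarrow> 0 \<le> l C"
    "(l has_sum 1) admissible_components" and bor: "sets \<mu> = sets borel"
    and eq: "\<And>B. B \<in> sets borel \<Longrightarrow> emeasure \<mu> B =
          (\<Sum>\<^sub>\<infinity>C\<in>admissible_components. ennreal (l C) * emeasure (component_prob C) (B \<inter> C))"
    by metis
  have sp: "space \<mu> = UNIV"
    using sets_eq_imp_space_eq[OF bor] by simp
  note cp = component_prob_compatible[OF compact countable]
  have one: "emeasure (component_prob C) C = 1" if C: "C \<in> admissible_components" for C :: "'a set"
  proof -
    interpret prob_space "component_prob C"
      using cp[OF C] by (simp add: isometrically_compatible_prob_def)
    have "sets (component_prob C) = sets (restrict_space borel C)"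
      using cp[OF C] by (simp add: isometrically_compatible_prob_def isometrically_compatible_def)
    then have "space (component_prob C) = C"
      using sets_eq_imp_space_eq[of "component_prob C"] by (simp add: space_restrict_space)
    then show ?thesis
      using emeasure_space_1 by simp
  qed
  have "emeasure \<mu> UNIV = (\<Sum>\<^sub>\<infinity>C\<in>admissible_components. ennreal (l C))"
    by (subst eq) (auto intro!: infsum_cong simp: one)
  also have "\<dots> = 1"
    using has_sum_iff_infsum_ennreal[of admissible_components l 1] l by simp
  finally have "prob_space \<mu>"
    by (intro prob_spaceI) (simp add: sp)
  moreover have "emeasure \<mu> U = emeasure \<mu> V" if f: "open U" "open V" "isometry_onto f U V" for U V f
  proof -
    have "emeasure (component_prob C) (U \<inter> C) = emeasure (component_prob C) (V \<inter> C)"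
      if C: "C \<in> admissible_components" for C
    proof (rule isometrically_compatibleD)
      show "isometrically_compatible C (component_prob C)"
        using cp[OF C] by (simp add: isometrically_compatible_prob_def)
      show "openin (top_of_set C) (U \<inter> C)" "openin (top_of_set C) (V \<inter> C)"
        using f by (simp_all add: Int_commute[of _ C] openin_open_Int)
      have "f ` (U \<inter> C) = V \<inter> C"
        using C by (intro isometry_image_component[OF f(3,1,2)]) (simp add: admissible_components_def)
      then show "isometry_onto f (U \<inter> C) (V \<inter> C)"
        using isometry_onto_subset[OF f(3), of "U \<inter> C"] by simp
    qed
    then show ?thesis
      using f by (simp add: eq cong: infsum_cong)
  qed
  ultimately show "isometrically_compatible_prob UNIV \<mu>"
    using bor by (auto simp: isometrically_compatible_prob_def isometrically_compatible_UNIV_iff)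
qed

text \<open>The reason why a probability concentrated on \<open>C\<close> is extreme: both ends of a
  segment through it turn out to be concentrated on \<open>C\<close>, and so coincide.\<close>

lemma compatible_prob_concentrated_unique:
  fixes C :: "'a::metric_space set"
  assumes compact: "compact (UNIV :: 'a set)" and countable: "countable (homogeneous_components :: 'a set set)"
    and C: "C \<in> homogeneous_components"
    and a: "isometrically_compatible_prob UNIV a" "measure a C = 1"
    and b: "isometrically_compatible_prob UNIV b" "measure b C = 1"
  shows "a = b"
proof (rule measure_eqI)
  have bor: "sets a = sets borel" "sets b = sets borel"
    using a b by (auto intro!: compatible_sets_UNIV simp: isometrically_compatible_prob_def)
  then show "sets a = sets b"
    by simp
  have "emeasure p B = emeasure (component_prob C) (B \<inter> C)"
    if p: "isometrically_compatible_prob UNIV p" "measure p C = 1" "sets p = sets borel" and B: "B \<in> sets borel" for p B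
  proof -
    interpret prob_space p
      using p by (simp add: isometrically_compatible_prob_def)
    have Cp: "C \<in> sets p"
      using component_borel[OF compact C] p by simp
    then have "AE x in p. x \<in> C"
      using p(2) AE_in_set_eq_1 by simp
    then have "emeasure p B = emeasure p (B \<inter> C)"
      using B Cp p(3) by (intro emeasure_eq_AE) auto
    also have "\<dots> = emeasure (component_prob C) (B \<inter> C)"
      using compatible_prob_on_component(2)[OF compact countable C p(1) _ B] p(2) by simp
    finally show ?thesis .
  qed
  then show "emeasure a A = emeasure b A" if "A \<in> sets a" for A
    using that a b bor by simp
qed

section \<open>Mixtures and convexity\<close>

text \<open>The convex combination is realised as a random choice: a Bernoulli coin with success
  probability \<open>u\<close> picks \<open>b\<close>, otherwise \<open>a\<close>.\<close>

lemma exists_mixture: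
  fixes a b :: "'a::metric_space measure"
  assumes a: "prob_space a" "sets a = sets borel" and b: "prob_space b" "sets b = sets borel"
    and u: "0 \<le> u" "u \<le> 1"
  obtains \<nu> where "prob_space \<nu>" "sets \<nu> = sets borel"
    "\<And>A. A \<in> sets borel \<Longrightarrow> measure \<nu> A = (1 - u) * measure a A + u * measure b A"
    "dual_functional \<nu> = (1 - u) *\<^sub>R dual_functional a + u *\<^sub>R dual_functional b"
proof -
  interpret a: prob_space a by fact
  interpret b: prob_space b by fact
  define N where "N x = (if x then b else a)" for x
  define \<nu> where "\<nu> = measure_pmf (bernoulli_pmf u) \<bind> N"
  have N: "N \<in> measure_pmf (bernoulli_pmf u) \<rightarrow>\<^sub>M subprob_algebra borel"
    unfolding N_def using a b
    by (auto simp: space_subprob_algebra prob_space_imp_subprob_space)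
  have sets: "sets \<nu> = sets borel"
    unfolding \<nu>_def using N by (intro sets_bind) (auto simp: N_def a b)
  have nn: "(\<integral>\<^sup>+x. f x \<partial>\<nu>) = ennreal (1 - u) * (\<integral>\<^sup>+x. f x \<partial>a) + ennreal u * (\<integral>\<^sup>+x. f x \<partial>b)"
    if "f \<in> borel_measurable borel" for f
    unfolding \<nu>_def nn_integral_bind[OF that N]
    using u by (simp add: N_def mult.commute add.commute)
  have em: "emeasure \<nu> A = ennreal ((1 - u) * measure a A + u * measure b A)" if A: "A \<in> sets borel" for A
    using nn[of "indicator A"] A u
    by (simp add: nn_integral_indicator sets a b a.emeasure_eq_measure b.emeasure_eq_measure ennreal_mult ennreal_plus)
  have meas: "measure \<nu> A = (1 - u) * measure a A + u * measure b A" if A: "A \<in> sets borel" for A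
    by (rule measure_eq_emeasure_eq_ennreal[OF _ em[OF A]]) (use u in simp)
  have sp: "space \<nu> = UNIV" "space a = UNIV" "space b = UNIV"
    using sets_eq_imp_space_eq[OF sets] sets_eq_imp_space_eq[OF a(2)] sets_eq_imp_space_eq[OF b(2)] by simp_all
  have prob: "prob_space \<nu>"
    using em[of UNIV] a.prob_space b.prob_space by (intro prob_spaceI) (simp add: sp)
  interpret \<nu>: prob_space \<nu> by fact
  have "dual_functional \<nu> = (1 - u) *\<^sub>R dual_functional a + u *\<^sub>R dual_functional b"
  proof (rule blinfun_eqI)
    fix f :: "'a \<Rightarrow>\<^sub>C real"
    have f: "apply_bcontfun f \<in> borel_measurable borel"
      by (intro borel_measurable_continuous_onI continuous_on_apply_bcontfun)
    have int: "integrable p (apply_bcontfun f)" if "sets p = sets borel" "prob_space p" for p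
      using that by (intro integrable_bcontfun) (auto simp: prob_space.finite_measure)
    \<comment> \<open>The mixing formula \<open>nn\<close> concerns nonnegative integrals. As
      \<open>ennreal\<close> sends negative reals to 0, these integrands are the positive and
      negative parts of \<open>f\<close>, to which it is applied separately.\<close>
    have fin: "(\<integral>\<^sup>+x. ennreal (apply_bcontfun f x) \<partial>p) \<noteq> \<infinity>" "(\<integral>\<^sup>+x. ennreal (- apply_bcontfun f x) \<partial>p) \<noteq> \<infinity>"
      if "sets p = sets borel" "prob_space p" for p
      using int[OF that] real_integrable_def[of p "apply_bcontfun f"] by auto
    obtain r s where rs: "(\<integral>\<^sup>+x. ennreal (apply_bcontfun f x) \<partial>a) = ennreal r" "0 \<le> r"
      "(\<integral>\<^sup>+x. ennreal (- apply_bcontfun f x) \<partial>a) = ennreal s" "0 \<le> s"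
      using fin[OF a(2,1)] by (metis ennreal_cases infinity_ennreal_def)
    obtain r' s' where rs': "(\<integral>\<^sup>+x. ennreal (apply_bcontfun f x) \<partial>b) = ennreal r'" "0 \<le> r'"
      "(\<integral>\<^sup>+x. ennreal (- apply_bcontfun f x) \<partial>b) = ennreal s'" "0 \<le> s'"
      using fin[OF b(2,1)] by (metis ennreal_cases infinity_ennreal_def)
    have "(\<integral>\<^sup>+x. ennreal (apply_bcontfun f x) \<partial>\<nu>) = ennreal ((1 - u) * r + u * r')"
      "(\<integral>\<^sup>+x. ennreal (- apply_bcontfun f x) \<partial>\<nu>) = ennreal ((1 - u) * s + u * s')"
      using f u rs rs' by (simp_all add: nn ennreal_mult ennreal_plus)
    moreover have "0 \<le> (1 - u) * r + u * r'" "0 \<le> (1 - u) * s + u * s'"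
      using u rs rs' by simp_all
    ultimately have i1: "integral\<^sup>L \<nu> (apply_bcontfun f) = ((1 - u) * r + u * r') - ((1 - u) * s + u * s')"
      by (simp add: real_lebesgue_integral_def[OF int[OF sets prob]])
    have i2: "integral\<^sup>L a (apply_bcontfun f) = r - s"
      using rs by (simp add: real_lebesgue_integral_def[OF int[OF a(2,1)]])
    have i3: "integral\<^sup>L b (apply_bcontfun f) = r' - s'"
      using rs' by (simp add: real_lebesgue_integral_def[OF int[OF b(2,1)]])
    have "integral\<^sup>L \<nu> (apply_bcontfun f) =
        (1 - u) * integral\<^sup>L a (apply_bcontfun f) + u * integral\<^sup>L b (apply_bcontfun f)"
      unfolding i1 i2 i3 by (simp add: algebra_simps)
    then show "blinfun_apply (dual_functional \<nu>) f =
        blinfun_apply ((1 - u) *\<^sub>R dual_functional a + u *\<^sub>R dual_functional b) f"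
      by (simp add: dual_functional_apply[OF sets \<nu>.finite_measure_axioms] dual_functional_apply[OF a(2) a.finite_measure_axioms]
          dual_functional_apply[OF b(2) b.finite_measure_axioms] blinfun.add_left blinfun.scaleR_left)
  qed
  then show ?thesis
    using that prob sets meas by blast
qed

lemma compatible_probs_iff:
  "\<mu> \<in> compatible_probs \<longleftrightarrow> prob_space \<mu> \<and> sets \<mu> = sets borel \<and>
    (\<forall>U V f. open U \<longrightarrow> open V \<longrightarrow> isometry_onto f U V \<longrightarrow> measure \<mu> U = measure \<mu> V)"
proof (cases "prob_space \<mu>")
  case True
  then interpret prob_space \<mu> .
  show ?thesis
    using True by (simp add: compatible_probs_def isometrically_compatible_prob_def
        isometrically_compatible_UNIV_iff emeasure_eq_measure)
qed (simp add: compatible_probs_def isometrically_compatible_prob_def)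

lemma compatible_mixture:
  fixes a b :: "'a::metric_space measure"
  assumes a: "a \<in> compatible_probs" and b: "b \<in> compatible_probs" and u: "0 \<le> u" "u \<le> 1"
  obtains \<nu> where "\<nu> \<in> compatible_probs"
    "\<And>A. A \<in> sets borel \<Longrightarrow> measure \<nu> A = (1 - u) * measure a A + u * measure b A"
    "dual_functional \<nu> = (1 - u) *\<^sub>R dual_functional a + u *\<^sub>R dual_functional b"
proof -
  have ab: "prob_space a" "sets a = sets borel" "prob_space b" "sets b = sets borel"
    using a b by (auto simp: compatible_probs_iff)
  obtain \<nu> where \<nu>: "prob_space \<nu>" "sets \<nu> = sets borel"
    "\<And>A. A \<in> sets borel \<Longrightarrow> measure \<nu> A = (1 - u) * measure a A + u * measure b A"
    "dual_functional \<nu> = (1 - u) *\<^sub>R dual_functional a + u *\<^sub>R dual_functional b"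
    using exists_mixture[OF ab u] by metis
  have "measure \<nu> U = measure \<nu> V" if "open U" "open V" "isometry_onto f U V" for U V f
  proof -
    have "measure a U = measure a V" "measure b U = measure b V"
      using a b that unfolding compatible_probs_iff by blast+
    then show ?thesis
      using that by (simp add: \<nu>(3))
  qed
  then have "\<nu> \<in> compatible_probs"
    using \<nu>(1,2) unfolding compatible_probs_iff by blast
  then show ?thesis
    using \<nu>(3,4) that by blast
qed

lemma convex_compatible_probs: "convex (dual_functional ` compatible_probs)"
proof (rule convexI)
  fix x y :: "('a \<Rightarrow>\<^sub>C real) \<Rightarrow>\<^sub>L real" and u v :: real
  assume "x \<in> dual_functional ` compatible_probs" "y \<in> dual_functional ` compatible_probs"
    and uv: "0 \<le> u" "0 \<le> v" "u + v = 1"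
  then obtain a b where ab: "a \<in> compatible_probs" "b \<in> compatible_probs" "x = dual_functional a" "y = dual_functional b"
    by blast
  have v: "v \<le> 1" "1 - v = u"
    using uv by auto
  obtain \<nu> where "\<nu> \<in> compatible_probs" "dual_functional \<nu> = (1 - v) *\<^sub>R dual_functional a + v *\<^sub>R dual_functional b"
    using compatible_mixture[OF ab(1,2) uv(2) v(1)] by metis
  then show "u *\<^sub>R x + v *\<^sub>R y \<in> dual_functional ` compatible_probs"
    using ab v by (metis image_eqI)
qed

lemma dual_functional_inject_compatible:
  assumes "a \<in> compatible_probs" "b \<in> compatible_probs" "dual_functional a = dual_functional b"
  shows "a = b"
  using assms inj_on_dual_functional unfolding inj_on_def
  by (auto simp: compatible_probs_iff prob_space.finite_measure)

section \<open>Conditioning and extreme points\<close>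

text \<open>Conditioning on a Borel set that is respected by all isometries between open sets keeps
  compatibility. It is used for a component and for its complement.\<close>

lemma compatible_uniform_measure:
  fixes \<mu> :: "'a::metric_space measure"
  assumes \<mu>: "\<mu> \<in> compatible_probs" and A: "A \<in> sets borel" "measure \<mu> A \<noteq> 0"
    and inv: "\<And>U V f. isometry_onto f U V \<Longrightarrow> open U \<Longrightarrow> open V \<Longrightarrow> f ` (U \<inter> A) = V \<inter> A"
  shows "uniform_measure \<mu> A \<in> compatible_probs"
proof -
  interpret prob_space \<mu>
    using \<mu> by (simp add: compatible_probs_iff)
  have bor: "sets \<mu> = sets borel"
    using \<mu> by (simp add: compatible_probs_iff)
  have comp: "isometrically_compatible UNIV \<mu>"
    using \<mu> by (simp add: compatible_probs_def isometrically_compatible_prob_def)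
  have "prob_space (uniform_measure \<mu> A)"
    using A by (intro prob_space_uniform_measure) (auto simp: emeasure_eq_measure)
  moreover have "measure (uniform_measure \<mu> A) U = measure (uniform_measure \<mu> A) V"
    if f: "open U" "open V" "isometry_onto f U V" for U V f
  proof -
    have "emeasure \<mu> (V \<inter> A) = emeasure \<mu> (U \<inter> A)"
      using compatible_emeasure_image[OF comp finite_measure_axioms f(3,1,2) A(1)] inv[OF f(3,1,2)] by simp
    then show ?thesis
      using f A bor by (simp add: measure_def Int_commute)
  qed
  ultimately show ?thesis
    using bor by (simp add: compatible_probs_iff)
qed

lemma extreme_compatible_probs:
  assumes compact: "compact (UNIV :: 'a::metric_space set)"
    and countable: "countable (homogeneous_components :: 'a set set)"
  shows "{\<phi>. \<phi> extreme_point_of (dual_functional ` (compatible_probs :: 'a measure set))} =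
       dual_functional ` {\<mu> \<in> compatible_probs. \<exists>C \<in> homogeneous_components.
         (\<exists>m. isometrically_compatible_prob C m) \<and> (AE x in \<mu>. x \<in> C)}"
    (is "?L = ?R")
proof (intro equalityI subsetI)
  fix \<phi> assume "\<phi> \<in> ?L"
  then obtain \<mu> :: "'a measure" where \<mu>: "\<mu> \<in> compatible_probs" "\<phi> = dual_functional \<mu>"
    and ext: "\<And>a b. a \<in> compatible_probs \<Longrightarrow> b \<in> compatible_probs \<Longrightarrow>
        dual_functional \<mu> \<notin> open_segment (dual_functional a) (dual_functional b)"
    unfolding extreme_point_of_def by auto
  interpret prob_space \<mu>
    using \<mu> by (simp add: compatible_probs_iff)
  have bor: "sets \<mu> = sets borel"
    using \<mu> by (simp add: compatible_probs_iff)
  have sp: "space \<mu> = UNIV"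
    using sets_eq_imp_space_eq[OF bor] by simp
  have comp: "isometrically_compatible_prob UNIV \<mu>"
    using \<mu> by (simp add: compatible_probs_def)
  \<comment> \<open>Countability enters here: if all components were null, the whole space would
    be.\<close>
  have "\<exists>C\<in>homogeneous_components. measure \<mu> C \<noteq> 0"
  proof (rule ccontr)
    assume "\<not> (\<exists>C\<in>homogeneous_components. measure \<mu> C \<noteq> 0)"
    then have "C \<in> null_sets \<mu>" if "C \<in> homogeneous_components" for C
      using that components_measurable[OF compact bor] by (auto simp: emeasure_eq_measure)
    then have "(\<Union>C\<in>homogeneous_components. C) \<in> null_sets \<mu>"
      using countable by (intro null_sets_UN')
    then show False
      using emeasure_space_1 by (simp add: Union_components sp null_sets_def)
  qed
  then obtain C where C: "C \<in> homogeneous_components" "measure \<mu> C \<noteq> 0"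
    by blast
  have Cb: "C \<in> sets borel"
    by (rule component_borel[OF compact C(1)])
  have compl: "measure \<mu> (- C) = 1 - measure \<mu> C"
    using prob_compl[of C] Cb by (simp add: bor sp Compl_eq_Diff_UNIV)
  have "measure \<mu> C = 1"
  proof (rule ccontr)
    assume ne: "measure \<mu> C \<noteq> 1"
    \<comment> \<open>With this weight \<open>1 - u\<close> and \<open>u\<close> are the measures of
      \<open>C\<close> and of its complement, and they cancel the normalisation of the two
      conditioned measures, so that their mixture is \<open>\<mu>\<close>.\<close>
    define u where "u = measure \<mu> (- C)"
    have u: "0 < u" "u < 1"
      using ne C(2) prob_le_1[of C] measure_nonneg[of \<mu> C] by (auto simp: u_def compl less_le)
    define a where "a = uniform_measure \<mu> C"
    define b where "b = uniform_measure \<mu> (- C)"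
    have a: "a \<in> compatible_probs"
      unfolding a_def by (rule compatible_uniform_measure[OF \<mu>(1) Cb C(2)])
        (rule isometry_image_component[OF _ _ _ C(1)])
    have b: "b \<in> compatible_probs"
      unfolding b_def
    proof (rule compatible_uniform_measure[OF \<mu>(1)])
      show "- C \<in> sets borel"
        using Cb by simp
      show "measure \<mu> (- C) \<noteq> 0"
        using u by (simp add: u_def)
      fix U V :: "'a set" and f
      assume f: "isometry_onto f U V" "open U" "open V"
      then show "f ` (U \<inter> - C) = V \<inter> - C"
        using isometry_mem_component_iff[OF f _ C(1)] unfolding isometry_onto_def by fastforce
    qed
    obtain \<nu> where \<nu>: "\<nu> \<in> compatible_probs"
      "\<And>A. A \<in> sets borel \<Longrightarrow> measure \<nu> A = (1 - u) * measure a A + u * measure b A"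
      "dual_functional \<nu> = (1 - u) *\<^sub>R dual_functional a + u *\<^sub>R dual_functional b"
      using compatible_mixture[OF a b] u by (metis less_imp_le)
    have "\<nu> = \<mu>"
    proof (rule measure_eqI)
      interpret \<nu>: prob_space \<nu>
        using \<nu>(1) by (simp add: compatible_probs_iff)
      show "sets \<nu> = sets \<mu>"
        using \<nu>(1) bor by (simp add: compatible_probs_iff)
      then show "emeasure \<nu> X = emeasure \<mu> X" if "X \<in> sets \<nu>" for X
      proof -
        have X: "X \<in> sets borel"
          using that \<open>sets \<nu> = sets \<mu>\<close> bor by simp
        have "measure a X = measure \<mu> (C \<inter> X) / (1 - u)" "measure b X = measure \<mu> (- C \<inter> X) / u"
          using X Cb C(2) u by (simp_all add: a_def b_def bor emeasure_eq_measure u_def compl)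
        then have "measure \<nu> X = measure \<mu> (C \<inter> X) + measure \<mu> (- C \<inter> X)"
          using u by (simp add: \<nu>(2)[OF X])
        also have "\<dots> = measure \<mu> ((C \<inter> X) \<union> (- C \<inter> X))"
          using X Cb by (intro finite_measure_Union[symmetric]) (auto simp: bor)
        also have "(C \<inter> X) \<union> (- C \<inter> X) = X"
          by blast
        finally show ?thesis
          by (simp add: emeasure_eq_measure \<nu>.emeasure_eq_measure)
      qed
    qed
    moreover have "measure a C = 1" "measure b C = 0"
      using C(2) Cb u by (simp_all add: a_def b_def bor emeasure_eq_measure u_def compl)
    then have "dual_functional a \<noteq> dual_functional b"
      using dual_functional_inject_compatible[OF a b] by auto
    ultimately have "dual_functional \<mu> \<in> open_segment (dual_functional a) (dual_functional b)"
      using \<nu>(3) u unfolding in_segment by auto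
    then show False
      using ext[OF a b] by blast
  qed
  then have "AE x in \<mu>. x \<in> C"
    using Cb by (simp add: AE_in_set_eq_1 bor)
  then show "\<phi> \<in> ?R"
    using \<mu> C compatible_restrict_component_prob[OF compact countable C(1) comp C(2)] by blast
next
  fix \<phi> assume "\<phi> \<in> ?R"
  then obtain \<mu> C where \<mu>: "\<mu> \<in> compatible_probs" "\<phi> = dual_functional \<mu>"
    and C: "C \<in> homogeneous_components" "AE x in \<mu>. x \<in> C"
    by blast
  interpret prob_space \<mu>
    using \<mu> by (simp add: compatible_probs_iff)
  have bor: "sets \<mu> = sets borel"
    using \<mu> by (simp add: compatible_probs_iff)
  have Cb: "C \<in> sets borel"
    by (rule component_borel[OF compact C(1)])
  have \<mu>C: "measure \<mu> C = 1"
    using C(2) Cb by (simp add: AE_in_set_eq_1 bor)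
  have "dual_functional \<mu> \<notin> open_segment (dual_functional a) (dual_functional b)"
    if a: "a \<in> compatible_probs" and b: "b \<in> compatible_probs" for a b
  proof
    assume "dual_functional \<mu> \<in> open_segment (dual_functional a) (dual_functional b)"
    then obtain u where ne: "dual_functional a \<noteq> dual_functional b" and u: "0 < u" "u < 1"
      and eq: "dual_functional \<mu> = (1 - u) *\<^sub>R dual_functional a + u *\<^sub>R dual_functional b"
      by (auto simp: in_segment)
    obtain \<nu> where \<nu>: "\<nu> \<in> compatible_probs"
      "\<And>A. A \<in> sets borel \<Longrightarrow> measure \<nu> A = (1 - u) * measure a A + u * measure b A"
      "dual_functional \<nu> = (1 - u) *\<^sub>R dual_functional a + u *\<^sub>R dual_functional b"
      using compatible_mixture[OF a b] u by (metis less_imp_le)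
    have "\<nu> = \<mu>"
      using dual_functional_inject_compatible[OF \<nu>(1) \<mu>(1)] \<nu>(3) eq by simp
    then have mix: "(1 - u) * measure a C + u * measure b C = 1"
      using \<nu>(2)[OF Cb] \<mu>C by simp
    interpret a: prob_space a
      using a by (simp add: compatible_probs_iff)
    interpret b: prob_space b
      using b by (simp add: compatible_probs_iff)
    \<comment> \<open>A mean, with positive weights, of two numbers that are at most 1 equals 1 only
      if both do.\<close>
    have "(1 - u) * measure a C \<le> 1 - u" "u * measure b C \<le> u"
      using u a.prob_le_1[of C] b.prob_le_1[of C] by (simp_all add: mult_left_le)
    then have "(1 - u) * measure a C = 1 - u" "u * measure b C = u"
      using mix by linarith+
    then have "measure a C = 1" "measure b C = 1"
      using u by simp_all
    then have "a = b"
      using compatible_prob_concentrated_unique[OF compact countable C(1)] a b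
      by (simp add: compatible_probs_def)
    then show False
      using ne by simp
  qed
  then show "\<phi> \<in> ?L"
    using \<mu> unfolding extreme_point_of_def by blast
qed

section \<open>Weak limits of probabilities\<close>

lemma compact_continuous_bcontfun:
  fixes f :: "'a::metric_space \<Rightarrow> real"
  assumes "compact (UNIV :: 'a set)" "continuous_on UNIV f"
  shows "f \<in> bcontfun"
  using compact_imp_bounded[OF compact_continuous_image[OF assms(2,1)]] assms(2)
  by (simp add: bcontfun_def)

text \<open>The minimum of finitely many cones \<open>v + L * dist x p\<close>, capped at
  \<open>c\<close>: a discrete inf-convolution, as in McShane's extension of Lipschitz functions.
  The list encoding makes it evident that rational data over a countable set of vertices give
  countably many functions.\<close>

primrec inf_conv :: "real \<Rightarrow> real \<Rightarrow> ('a::metric_space \<times> real) list \<Rightarrow> 'a \<Rightarrow> real" where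
  "inf_conv c L [] x = c"
| "inf_conv c L (a # as) x = min (snd a + L * dist x (fst a)) (inf_conv c L as x)"

lemma inf_conv_le: "a \<in> set as \<Longrightarrow> inf_conv c L as x \<le> snd a + L * dist x (fst a)"
  by (induction as) (auto simp: min_le_iff_disj)

lemma inf_conv_ge:
  "t \<le> c \<Longrightarrow> (\<And>a. a \<in> set as \<Longrightarrow> t \<le> snd a + L * dist x (fst a)) \<Longrightarrow> t \<le> inf_conv c L as x"
  by (induction as) auto

lemma continuous_on_inf_conv: "continuous_on S (inf_conv c L as)"
  by (induction as) (auto simp del: inf_conv.simps simp: inf_conv.simps[abs_def] intro!: continuous_intros)

text \<open>Cones of slope \<open>L\<close> with vertices slightly above the graph of
  \<open>f\<close> approximate it. A vertex close to \<open>x\<close> bounds the minimum from above;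
  from below, cones with vertex within \<open>\<delta>\<close> are controlled by uniform continuity,
  and those further away have risen by more than the oscillation of \<open>f\<close>.\<close>

lemma countable_uniformly_dense_bcontfun:
  assumes compact: "compact (UNIV :: 'a::metric_space set)"
  obtains F :: "nat \<Rightarrow> 'a::metric_space \<Rightarrow>\<^sub>C real"
  where "\<And>f e. 0 < e \<Longrightarrow> \<exists>i. \<forall>x. \<bar>apply_bcontfun (F i) x - apply_bcontfun f x\<bar> \<le> e"
proof -
  obtain D :: "'a set" where D: "countable D" "\<And>x e. 0 < e \<Longrightarrow> \<exists>p\<in>D. dist x p < e"
    using compact_imp_countable_dense[OF compact] by blast
  define \<F> where "\<F> = (\<lambda>(c, L, as). Bcontfun (inf_conv c (real L) as)) `
    (\<rat> \<times> (UNIV :: nat set) \<times> lists (D \<times> \<rat>))"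
  have F: "countable \<F>"
    unfolding \<F>_def using D(1) countable_rat
    by (intro countable_image countable_SIGMA countable_lists) auto
  have ne: "\<F> \<noteq> {}"
    unfolding \<F>_def by (auto simp: lists_empty ex_in_conv[symmetric] intro!: exI[of _ 0] exI[of _ "[]"])
  have dense: "\<exists>h\<in>\<F>. \<forall>x. \<bar>apply_bcontfun h x - apply_bcontfun f x\<bar> \<le> e" if e0: "0 < e" for f :: "'a \<Rightarrow>\<^sub>C real" and e
  proof -
    define e' where "e' = e / 3"
    have e: "0 < e'"
      using e0 by (simp add: e'_def)
    have M: "\<bar>apply_bcontfun f x\<bar> \<le> norm f" for x
      using norm_bounded[of f x] by simp
    have "uniformly_continuous_on UNIV (apply_bcontfun f)"
      by (intro compact_uniformly_continuous[OF _ compact] continuous_on_apply_bcontfun)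
    then obtain \<delta> where \<delta>: "0 < \<delta>" "\<And>x y. dist x y < \<delta> \<Longrightarrow> \<bar>apply_bcontfun f x - apply_bcontfun f y\<bar> < e'"
      using e unfolding uniformly_continuous_on_def dist_real_def by (metis UNIV_I)
    \<comment> \<open>At distance \<open>\<delta>\<close> from its vertex a cone has risen by more
      than \<open>2 * norm f\<close>, and so lies above \<open>f\<close>.\<close>
    obtain L :: nat where L: "2 * norm f < real L * \<delta>"
      using reals_Archimedean3[OF \<delta>(1)] by blast
    \<comment> \<open>The mesh of the finite net: over a distance \<open>s\<close> a cone rises by
      at most \<open>e'\<close>. The other two thirds of \<open>e\<close> pay for the height of the
      vertices and for the variation of \<open>f\<close>. The \<open>+ 1\<close> covers
      \<open>L = 0\<close>.\<close>
    define s where "s = min \<delta> (e' / (real L + 1))"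
    have s: "0 < s" "s \<le> \<delta>" "real L * s \<le> e'"
    proof -
      show "0 < s" "s \<le> \<delta>"
        using \<delta>(1) e by (auto simp: s_def)
      have "real L * s \<le> (real L + 1) * s"
        using \<open>0 < s\<close> by simp
      also have "\<dots> \<le> (real L + 1) * (e' / (real L + 1))"
        by (intro mult_left_mono) (auto simp: s_def)
      finally show "real L * s \<le> e'"
        by simp
    qed
    have "(UNIV :: 'a set) \<subseteq> (\<Union>p\<in>D. ball p s)"
      using D(2)[OF s(1)] by (auto simp: dist_commute)
    then obtain D0 where D0: "D0 \<subseteq> D" "finite D0" "(UNIV :: 'a set) \<subseteq> (\<Union>p\<in>D0. ball p s)"
      using compactE_image[OF compact, of D "\<lambda>p. ball p s"] by (metis open_ball)
    have "\<exists>q\<in>\<rat>. apply_bcontfun f p < q \<and> q < apply_bcontfun f p + e'" for p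
      using Rats_dense_in_real[of "apply_bcontfun f p" "apply_bcontfun f p + e'"] e by auto
    then obtain q where q: "\<And>p. q p \<in> \<rat>" "\<And>p. apply_bcontfun f p < q p" "\<And>p. q p < apply_bcontfun f p + e'"
      by metis
    obtain c where c: "c \<in> \<rat>" "norm f < c"
      using Rats_dense_in_real[of "norm f" "norm f + 1"] by auto
    obtain ds where ds: "set ds = D0"
      using finite_list[OF D0(2)] by blast
    define as where "as = map (\<lambda>p. (p, q p)) ds"
    define h where "h = Bcontfun (inf_conv c (real L) as)"
    have h: "apply_bcontfun h = inf_conv c (real L) as"
      unfolding h_def by (intro Bcontfun_inverse compact_continuous_bcontfun[OF compact] continuous_on_inf_conv)
    have "as \<in> lists (D \<times> \<rat>)"
      using ds D0(1) q(1) by (auto simp: as_def)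
    then have "h \<in> \<F>"
      unfolding \<F>_def h_def using c(1) by (intro image_eqI[of _ _ "(c, L, as)"]) auto
    moreover have "\<bar>apply_bcontfun h x - apply_bcontfun f x\<bar> \<le> e" for x
    proof -
      obtain p where p: "p \<in> D0" "dist p x < s"
        using D0(3) by (metis UN_E UNIV_I mem_ball subsetD)
      have "inf_conv c (real L) as x \<le> q p + real L * dist x p"
        using inf_conv_le[of "(p, q p)" as c "real L" x] p(1) ds by (simp add: as_def)
      also have "\<dots> \<le> q p + real L * s"
        using p(2) by (simp add: dist_commute mult_left_mono)
      also have "\<dots> \<le> apply_bcontfun f x + e"
      proof -
        have "\<bar>apply_bcontfun f p - apply_bcontfun f x\<bar> < e'" "e = 3 * e'"
          using \<delta>(2)[of p x] p(2) s(2) by (auto simp: e'_def)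
        then show ?thesis
          using q(3)[of p] s(3) by linarith
      qed
      finally have upper: "inf_conv c (real L) as x \<le> apply_bcontfun f x + e" .
      have lower: "apply_bcontfun f x - e \<le> inf_conv c (real L) as x"
      proof (rule inf_conv_ge)
        show "apply_bcontfun f x - e \<le> c"
          using M[of x] c(2) e0 by simp
        fix a assume "a \<in> set as"
        then obtain p where a: "a = (p, q p)"
          by (auto simp: as_def)
        show "apply_bcontfun f x - e \<le> snd a + real L * dist x (fst a)"
        proof (cases "dist x p < \<delta>")
          case True
          have "0 \<le> real L * dist x p" "e' \<le> e"
            using e0 by (simp_all add: e'_def)
          then show ?thesis
            using \<delta>(2)[OF True] q(2)[of p] unfolding a fst_conv snd_conv by linarith
        next
          case False
          then have "real L * \<delta> \<le> real L * dist x p"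
            by (intro mult_left_mono) auto
          then show ?thesis
            using L M[of x] M[of p] q(2)[of p] e0 unfolding a fst_conv snd_conv by linarith
        qed
      qed
      show ?thesis
        using upper lower by (simp add: h abs_le_iff)
    qed
    ultimately show ?thesis
      by blast
  qed
  have "\<exists>i. \<forall>x. \<bar>apply_bcontfun (from_nat_into \<F> i) x - apply_bcontfun f x\<bar> \<le> e" if "0 < e" for f :: "'a \<Rightarrow>\<^sub>C real" and e
    using dense[OF that, of f] from_nat_into_surj[OF F] by metis
  then show ?thesis
    by (rule that)
qed

section \<open>Coding points by reals\<close>

text \<open>The point of the Cantor set whose ternary digits 0 and 2 record membership in the sets
  \<open>b n\<close>. Unlike binary expansions, these have gaps, so close codes force equal initial
  digits.\<close>

definition ternary_code :: "(nat \<Rightarrow> 'a set) \<Rightarrow> 'a \<Rightarrow> real" where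
  "ternary_code b x = (\<Sum>n. 2 * indicator (b n) x * (1 / 3) ^ Suc n)"

lemma summable_ternary_code: "summable (\<lambda>n. 2 * indicator (b n) x * (1 / 3 :: real) ^ Suc n)"
proof (rule summable_comparison_test'[of "\<lambda>n. 2 * (1 / 3 :: real) ^ Suc n" 0])
  show "summable (\<lambda>n. 2 * (1 / 3 :: real) ^ Suc n)"
    unfolding summable_Suc_iff[of "\<lambda>n. 2 * (1 / 3 :: real) ^ n"]
    by (intro summable_mult summable_geometric) simp
qed (auto simp: indicator_def)

lemma ternary_code_Suc:
  "ternary_code b x = (2 * indicator (b 0) x + ternary_code (\<lambda>n. b (Suc n)) x) / 3"
proof -
  have "ternary_code b x = 2 * indicator (b 0) x / 3 + (\<Sum>n. 2 * indicator (b (Suc n)) x * (1 / 3) ^ Suc (Suc n))"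
    using suminf_split_head[OF summable_ternary_code[of b x]] by (simp add: ternary_code_def)
  also have "(\<Sum>n. 2 * indicator (b (Suc n)) x * (1 / 3 :: real) ^ Suc (Suc n)) =
      (\<Sum>n. (2 * indicator (b (Suc n)) x * (1 / 3) ^ Suc n) / 3)"
    by (intro arg_cong[where f = suminf]) (auto simp: field_simps)
  also have "\<dots> = ternary_code (\<lambda>n. b (Suc n)) x / 3"
    unfolding ternary_code_def by (rule suminf_divide[OF summable_ternary_code])
  finally show ?thesis
    by (simp add: field_simps)
qed

lemma ternary_code_bounds: "0 \<le> ternary_code b x" "ternary_code b x \<le> 1"
proof -
  show "0 \<le> ternary_code b x"
    unfolding ternary_code_def by (intro suminf_nonneg summable_ternary_code) (auto simp: indicator_def)
  have geo: "(\<lambda>n. 2 * ((1 / 3 :: real) ^ Suc n)) sums 1"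
    using sums_mult[OF geometric_sums[of "1 / 3 :: real"], of "2 / 3"] by (simp add: mult.assoc)
  have "ternary_code b x \<le> (\<Sum>n. 2 * ((1 / 3 :: real) ^ Suc n))"
    unfolding ternary_code_def
    by (intro suminf_le summable_ternary_code sums_summable[OF geo]) (auto simp: indicator_def)
  then show "ternary_code b x \<le> 1"
    using sums_unique[OF geo] by simp
qed

text \<open>After scaling by 3, different leading digits contribute 2 and the tails take back at
  most 1, so the codes would be too far apart.\<close>

lemma ternary_code_close_imp_same_bits:
  assumes "\<bar>ternary_code b x - ternary_code b y\<bar> < (1 / 3) ^ N" "n < N"
  shows "x \<in> b n \<longleftrightarrow> y \<in> b n"
  using assms
proof (induction N arbitrary: b n)
  case 0
  then show ?case
    by simp
next
  case (Suc N)
  let ?b = "\<lambda>n. b (Suc n)"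
  have eq: "3 * (ternary_code b x - ternary_code b y) =
      2 * (indicator (b 0) x - indicator (b 0) y) + (ternary_code ?b x - ternary_code ?b y)"
    by (subst (1 2) ternary_code_Suc) (simp add: field_simps)
  have close: "\<bar>3 * (ternary_code b x - ternary_code b y)\<bar> < (1 / 3) ^ N"
    using Suc.prems(1) unfolding abs_mult by simp
  have "(1 / 3 :: real) ^ N \<le> 1"
    by (simp add: power_le_one)
  then have head: "x \<in> b 0 \<longleftrightarrow> y \<in> b 0"
    using close ternary_code_bounds[of ?b x] ternary_code_bounds[of ?b y] unfolding eq
    by (cases "x \<in> b 0"; cases "y \<in> b 0") auto
  then have "\<bar>ternary_code ?b x - ternary_code ?b y\<bar> < (1 / 3) ^ N"
    using close unfolding eq by (simp add: indicator_def)
  then show ?case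
    using Suc.IH[of ?b "n - 1"] Suc.prems(2) head by (cases n) auto
qed

text \<open>
  Turns weak compactness of probabilities on the space into Helly's theorem.
\<close>

lemma compact_real_code:
  assumes compact: "compact (UNIV :: 'a::metric_space set)"
  obtains s :: "'a::metric_space \<Rightarrow> real" where "s \<in> borel_measurable borel" "\<And>x. 0 \<le> s x" "\<And>x. s x \<le> 1"
    "\<And>e. 0 < e \<Longrightarrow> \<exists>\<eta>>0. \<forall>x y. \<bar>s x - s y\<bar> < \<eta> \<longrightarrow> dist x y < e"
proof -
  obtain \<B> :: "'a set set" where \<B>: "countable \<B>" "\<And>b. b \<in> \<B> \<Longrightarrow> open b"
    "\<And>U x. open U \<Longrightarrow> x \<in> U \<Longrightarrow> \<exists>b\<in>\<B>. x \<in> b \<and> b \<subseteq> U"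
    using compact_imp_countable_base[OF compact] by metis
  have ne: "\<B> \<noteq> {}"
    using \<B>(3)[OF open_UNIV UNIV_I] by blast
  define b where "b = from_nat_into \<B>"
  have b: "open (b n)" for n
    unfolding b_def by (rule \<B>(2)[OF from_nat_into[OF ne]])
  define s where "s = ternary_code b"
  have "s \<in> borel_measurable borel"
    unfolding s_def ternary_code_def[abs_def] using b
    by (intro borel_measurable_suminf borel_measurable_times borel_measurable_indicator borel_measurable_const) auto
  moreover have "\<exists>\<eta>>0. \<forall>x y. \<bar>s x - s y\<bar> < \<eta> \<longrightarrow> dist x y < e" if e: "0 < e" for e
  proof -
    have "\<exists>n. x \<in> b n \<and> b n \<subseteq> ball x (e / 2)" for x
      using \<B>(3)[of "ball x (e / 2)" x] e from_nat_into_surj[OF \<B>(1)] unfolding b_def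
      by (metis centre_in_ball half_gt_zero open_ball)
    then obtain n where n: "\<And>x. x \<in> b (n x)" "\<And>x. b (n x) \<subseteq> ball x (e / 2)"
      by metis
    obtain X where X: "finite X" "UNIV \<subseteq> (\<Union>x\<in>X. b (n x))"
      using compactE_image[OF compact, of UNIV "\<lambda>x. b (n x)"] b n(1) by (metis UNIV_I UN_I subsetI)
    \<comment> \<open>Agreement of the first \<open>N\<close> digits covers the indices of all
      members of the finite cover.\<close>
    define N where "N = Suc (Max (n ` X))"
    have "dist x y < e" if xy: "\<bar>s x - s y\<bar> < (1 / 3) ^ N" for x y
    proof -
      obtain z where z: "z \<in> X" "x \<in> b (n z)"
        using X(2) by blast
      then have "n z < N"
        using X(1) by (simp add: N_def le_imp_less_Suc)
      then have "y \<in> b (n z)"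
        using ternary_code_close_imp_same_bits[OF xy[unfolded s_def]] z(2) by blast
      then have "dist z x < e / 2" "dist z y < e / 2"
        using z(2) n(2)[of z] by auto
      then show ?thesis
        using dist_triangle[of x y z] by (simp add: dist_commute)
    qed
    then show ?thesis
      by (intro exI[of _ "(1 / 3) ^ N"]) auto
  qed
  ultimately show ?thesis
    by (intro that[of s]) (auto simp: s_def ternary_code_bounds)
qed

section \<open>Weak sequential compactness\<close>

text \<open>The images under the code live on the unit interval and so are tight; the limit
  \<open>q\<close> obtained there is carried back by the extended inverse \<open>\<phi>\<close> of
  the code.\<close>

lemma prob_sequence_weak_limit:
  fixes \<mu> :: "nat \<Rightarrow> 'a::metric_space measure"
  assumes compact: "compact (UNIV :: 'a set)"
    and \<mu>: "\<And>k. prob_space (\<mu> k)" "\<And>k. sets (\<mu> k) = sets borel"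
  obtains r :: "nat \<Rightarrow> nat" and \<nu> :: "'a measure" where "strict_mono r" "prob_space \<nu>" "sets \<nu> = sets borel"
    "\<And>f :: 'a \<Rightarrow> real. continuous_on UNIV f \<Longrightarrow> (\<lambda>k. integral\<^sup>L (\<mu> (r k)) f) \<longlonglongrightarrow> integral\<^sup>L \<nu> f"
proof -
  obtain s :: "'a \<Rightarrow> real" where s: "s \<in> borel_measurable borel" "\<And>x. 0 \<le> s x" "\<And>x. s x \<le> 1"
    "\<And>e. 0 < e \<Longrightarrow> \<exists>\<eta>>0. \<forall>x y. \<bar>s x - s y\<bar> < \<eta> \<longrightarrow> dist x y < e"
    using compact_real_code[OF compact] by blast
  have sm: "s \<in> \<mu> k \<rightarrow>\<^sub>M borel" for k
    using s(1) measurable_cong_sets[OF \<mu>(2) refl] by blast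
  have sp: "space (\<mu> k) = UNIV" for k
    using sets_eq_imp_space_eq[OF \<mu>(2)] by simp
  define p where "p k = distr (\<mu> k) borel s" for k
  have p: "real_distribution (p k)" for k
    unfolding p_def by (rule prob_space.real_distribution_distr[OF \<mu>(1) sm])
  have ip: "integral\<^sup>L (p k) g = integral\<^sup>L (\<mu> k) (\<lambda>x. g (s x))" if "continuous_on UNIV g" for g :: "real \<Rightarrow> real" and k
    unfolding p_def using that by (intro integral_distr sm borel_measurable_continuous_onI)
  have "tight p"
    unfolding tight_def
  proof (intro conjI allI impI)
    fix \<epsilon> :: real assume \<epsilon>: "0 < \<epsilon>"
    \<comment> \<open>Tightness is formulated with half-open intervals; the end point
      \<open>-1\<close> makes room for the code 0.\<close>
    have "measure (p k) {-1<..1} = 1" for k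
    proof -
      have "s -` {-1<..1} \<inter> space (\<mu> k) = space (\<mu> k)"
      proof -
        have "s x \<in> {-1<..1}" for x
          using s(2)[of x] s(3)[of x] by simp
        then show ?thesis
          by blast
      qed
      then show ?thesis
        unfolding p_def using prob_space.prob_space[OF \<mu>(1)] by (subst measure_distr[OF sm]) auto
    qed
    then show "\<exists>a b. a < b \<and> (\<forall>n. 1 - \<epsilon> < measure (p n) {a<..b})"
      using \<epsilon> by (intro exI[of _ "-1"] exI[of _ 1]) simp
  qed (rule p)
  then obtain r q where r: "strict_mono (r :: nat \<Rightarrow> nat)" and q: "real_distribution q" and w: "weak_conv_m (p \<circ> id \<circ> r) q"
    using tight_imp_convergent_subsubsequence[of p id] by (auto simp: strict_mono_def)
  interpret q: real_distribution q by fact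
  have conv: "(\<lambda>k. integral\<^sup>L (\<mu> (r k)) (\<lambda>x. g (s x))) \<longlonglongrightarrow> integral\<^sup>L q g"
    if g: "continuous_on UNIV g" "\<And>t. \<bar>g t\<bar> \<le> B" for g :: "real \<Rightarrow> real" and B
  proof -
    have "(\<lambda>k. integral\<^sup>L ((p \<circ> id \<circ> r) k) g) \<longlonglongrightarrow> integral\<^sup>L q g"
      using g by (intro weak_conv_imp_integral_bdd_continuous_conv[OF _ q w, of g B])
        (auto intro: p simp: continuous_on_eq_continuous_at)
    then show ?thesis
      by (simp add: ip[OF g(1)])
  qed
  \<comment> \<open>The limit \<open>q\<close> may charge limit points of the codes that are not
    codes themselves, so the inverse has to be defined on the closure.\<close>
  define Z where "Z = closure (range s)"
  have Z: "closed Z" "Z \<noteq> {}" "s x \<in> Z" for x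
    unfolding Z_def using closure_subset[of "range s"] by auto
  have "AE t in q. t \<in> Z"
  proof -
    \<comment> \<open>A bounded continuous function vanishing exactly on \<open>Z\<close>; its
      integrals along the sequence are 0, hence so is its integral under \<open>q\<close>.\<close>
    define F where "F t = min 1 (infdist t Z)" for t
    have F: "continuous_on UNIV F" "\<And>t. \<bar>F t\<bar> \<le> 1"
      unfolding F_def by (auto intro!: continuous_intros simp: infdist_nonneg)
    have "F (s x) = 0" for x
      using Z(3) by (simp add: F_def)
    then have "integral\<^sup>L q F = 0"
      using conv[OF F] by (simp add: LIMSEQ_const_iff)
    moreover have "integrable q F"
    proof (rule q.integrable_const_bound[of _ 1])
      show "F \<in> borel_measurable q"
        using borel_measurable_continuous_onI[OF F(1)] measurable_cong_sets[OF q.events_eq_borel refl] by blast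
    qed (simp add: F(2))
    ultimately have "AE t in q. F t = 0"
      by (subst (asm) integral_nonneg_eq_0_iff_AE) (auto simp: F_def infdist_nonneg)
    then show ?thesis
      by eventually_elim (use in_closed_iff_infdist_zero[OF Z(1,2)] in \<open>auto simp: F_def min_def split: if_splits\<close>)
  qed
  have Zb: "Z \<in> sets q"
    using Z(1) by simp
  have qZ: "emeasure q Z = 1"
    using \<open>AE t in q. t \<in> Z\<close> Zb by (simp add: q.emeasure_eq_measure q.AE_in_set_eq_1)
  \<comment> \<open>The value of the extended inverse at \<open>z\<close>: points with codes tending
    to \<open>z\<close> cluster somewhere by compactness, and by uniform continuity all points with
    codes near \<open>z\<close> are near that place.\<close>
  have "\<exists>c. \<forall>e>0. \<exists>\<delta>>0. \<forall>x. \<bar>s x - z\<bar> < \<delta> \<longrightarrow> dist x c < e" if z: "z \<in> Z" for z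
  proof -
    have "\<forall>k. \<exists>x. \<bar>s x - z\<bar> < 1 / Suc k"
      using z unfolding Z_def closure_approachable by (auto simp: dist_real_def)
    then obtain y where y: "\<And>k. \<bar>s (y k) - z\<bar> < 1 / Suc k"
      by metis
    obtain l t where l: "strict_mono (t :: nat \<Rightarrow> nat)" "(y \<circ> t) \<longlonglongrightarrow> l"
      using compact unfolding compact_eq_seq_compact_metric seq_compact_def by (metis UNIV_I)
    have "\<exists>\<delta>>0. \<forall>x. \<bar>s x - z\<bar> < \<delta> \<longrightarrow> dist x l < e" if e: "0 < e" for e
    proof -
      obtain \<eta> where \<eta>: "0 < \<eta>" "\<And>x y. \<bar>s x - s y\<bar> < \<eta> \<Longrightarrow> dist x y < e / 2"
        using s(4)[of "e / 2"] e by auto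
      have "\<forall>\<^sub>F k in sequentially. dist (y (t k)) l < e / 2"
        using tendstoD[OF l(2), of "e / 2"] e by (simp add: o_def)
      moreover have "\<forall>\<^sub>F k in sequentially. 1 / real (Suc k) < \<eta> / 2"
        using order_tendstoD(2)[OF LIMSEQ_inverse_real_of_nat, of "\<eta> / 2"] \<eta>(1) by (simp add: inverse_eq_divide)
      ultimately obtain k where k: "dist (y (t k)) l < e / 2" "1 / real (Suc k) < \<eta> / 2"
        using eventually_happens'[OF sequentially_bot eventually_conj] by blast
      have "1 / real (Suc (t k)) \<le> 1 / real (Suc k)"
        using seq_suble[OF l(1), of k] by (simp add: frac_le)
      then have "\<bar>s (y (t k)) - z\<bar> < \<eta> / 2"
        using y[of "t k"] k(2) by simp
      moreover have "dist x l < e" if "\<bar>s x - z\<bar> < \<eta> / 2" "\<bar>s (y (t k)) - z\<bar> < \<eta> / 2" for x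
      proof -
        have "\<bar>s x - s (y (t k))\<bar> < \<eta>"
          using that by linarith
        then show ?thesis
          using \<eta>(2)[of x "y (t k)"] k(1) dist_triangle[of x l "y (t k)"] by simp
      qed
      ultimately show ?thesis
        using \<eta>(1) by (intro exI[of _ "\<eta> / 2"]) auto
    qed
    then show ?thesis
      by blast
  qed
  then obtain \<phi> where \<phi>: "\<And>z e. z \<in> Z \<Longrightarrow> 0 < e \<Longrightarrow> \<exists>\<delta>>0. \<forall>x. \<bar>s x - z\<bar> < \<delta> \<longrightarrow> dist x (\<phi> z) < e"
    by metis
  have \<phi>s: "\<phi> (s x) = x" for x
  proof (rule ccontr)
    assume "\<phi> (s x) \<noteq> x"
    then obtain \<delta> where \<delta>: "0 < \<delta>" "\<And>y. \<bar>s y - s x\<bar> < \<delta> \<Longrightarrow> dist y (\<phi> (s x)) < dist x (\<phi> (s x))"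
      using \<phi>[OF Z(3)[of x], of "dist x (\<phi> (s x))"] by auto
    show False
      using \<delta>(2)[of x] \<delta>(1) by simp
  qed
  have cont: "continuous_on Z \<phi>"
    unfolding continuous_on_iff
  proof (intro ballI allI impI)
    fix z and e :: real assume z: "z \<in> Z" and e: "0 < e"
    obtain \<delta> where \<delta>: "0 < \<delta>" "\<And>x. \<bar>s x - z\<bar> < \<delta> \<Longrightarrow> dist x (\<phi> z) < e / 2"
      using \<phi>[OF z, of "e / 2"] e by auto
    have "dist (\<phi> z') (\<phi> z) < e" if z': "z' \<in> Z" "dist z' z < \<delta> / 2" for z'
    proof -
      obtain \<delta>' where \<delta>': "0 < \<delta>'" "\<And>x. \<bar>s x - z'\<bar> < \<delta>' \<Longrightarrow> dist x (\<phi> z') < e / 2"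
        using \<phi>[OF z'(1), of "e / 2"] e by auto
      have "0 < min \<delta>' (\<delta> / 2)"
        using \<delta>(1) \<delta>'(1) by simp
      then obtain x where "\<bar>s x - z'\<bar> < min \<delta>' (\<delta> / 2)"
        using z'(1) unfolding Z_def closure_approachable dist_real_def by blast
      moreover from this have "\<bar>s x - z\<bar> < \<delta>"
        using z'(2) unfolding dist_real_def by linarith
      ultimately have "dist x (\<phi> z') < e / 2" "dist x (\<phi> z) < e / 2"
        using \<delta>(2)[of x] \<delta>'(2)[of x] by auto
      then show ?thesis
        using dist_triangle[of "\<phi> z'" "\<phi> z" x] by (simp add: dist_commute)
    qed
    then show "\<exists>d>0. \<forall>x'\<in>Z. dist x' z < d \<longrightarrow> dist (\<phi> x') (\<phi> z) < e"
      using \<delta>(1) by (intro exI[of _ "\<delta> / 2"]) auto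
  qed
  define \<nu> where "\<nu> = distr (restrict_space q Z) borel \<phi>"
  have \<phi>m: "\<phi> \<in> restrict_space q Z \<rightarrow>\<^sub>M borel"
    using borel_measurable_continuous_on_restrict[OF cont]
      measurable_cong_sets[OF sets_restrict_space_cong[OF q.events_eq_borel] refl] by blast
  have "prob_space \<nu>"
    unfolding \<nu>_def by (intro prob_space.prob_space_distr prob_space_restrict_space Zb qZ \<phi>m)
  moreover have "(\<lambda>k. integral\<^sup>L (\<mu> (r k)) f) \<longlonglongrightarrow> integral\<^sup>L \<nu> f" if f: "continuous_on UNIV f" for f :: "'a \<Rightarrow> real"
  proof -
    obtain B where B: "0 \<le> B" "\<And>x. \<bar>f x\<bar> \<le> B"
      using compact_imp_bounded[OF compact_continuous_image[OF f compact]]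
      unfolding bounded_pos by (metis less_imp_le rangeI real_norm_def)
    have "continuous_on Z (f \<circ> \<phi>)"
      using cont continuous_on_subset[OF f] by (intro continuous_on_compose) auto
    \<comment> \<open>Test functions for weak convergence must be continuous on all reals, hence the
      Tietze extension.\<close>
    then obtain g where g: "continuous_on UNIV g" "\<And>z. z \<in> Z \<Longrightarrow> g z = f (\<phi> z)" "\<And>t. \<bar>g t\<bar> \<le> B"
      using Tietze[of Z "f \<circ> \<phi>" UNIV B] Z(1) B by (auto simp: o_def)
    have "integral\<^sup>L \<nu> f = integral\<^sup>L (restrict_space q Z) (\<lambda>z. f (\<phi> z))"
      unfolding \<nu>_def using f by (intro integral_distr \<phi>m borel_measurable_continuous_onI)
    also have "\<dots> = integral\<^sup>L q (\<lambda>z. indicator Z z *\<^sub>R f (\<phi> z))"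
      using Zb by (intro integral_restrict_space) auto
    also have "\<dots> = integral\<^sup>L q (\<lambda>z. indicator Z z *\<^sub>R g z)"
      by (intro Bochner_Integration.integral_cong) (auto simp: g(2) indicator_def)
    also have "\<dots> = integral\<^sup>L q g"
    proof (rule integral_cong_AE)
      show gm: "g \<in> borel_measurable q"
        using borel_measurable_continuous_onI[OF g(1)] by simp
      show "(\<lambda>z. indicator Z z *\<^sub>R g z) \<in> borel_measurable q"
        using Zb gm by (intro borel_measurable_scaleR borel_measurable_indicator) auto
      show "AE z in q. indicator Z z *\<^sub>R g z = g z"
        using \<open>AE t in q. t \<in> Z\<close> by eventually_elim simp
    qed
    finally show ?thesis
      using conv[OF g(1,3)] by (simp add: g(2)[OF Z(3)] \<phi>s)
  qed
  ultimately show ?thesis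
    using that[OF r] by (simp add: \<nu>_def)
qed

section \<open>Compactness\<close>

text \<open>The closed sets \<open>K j\<close> inside \<open>U\<close> matter as much as the
  convergence: they allow the cut-off functions to be transported to \<open>V\<close> and continued
  by zero without losing continuity.\<close>

lemma open_cutoff:
  fixes U :: "'a::metric_space set"
  assumes U: "open U"
  obtains \<rho> :: "nat \<Rightarrow> 'a \<Rightarrow> real" and K :: "nat \<Rightarrow> 'a set"
  where "\<And>j. continuous_on UNIV (\<rho> j)" "\<And>j x. 0 \<le> \<rho> j x" "\<And>j x. \<rho> j x \<le> 1"
    "\<And>x. (\<lambda>j. \<rho> j x) \<longlonglongrightarrow> indicator U x"
    "\<And>j. closed (K j)" "\<And>j. K j \<subseteq> U" "\<And>j x. x \<notin> K j \<Longrightarrow> \<rho> j x = 0"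
proof (cases "U = UNIV")
  case True
  show ?thesis
    by (rule that[of "\<lambda>_ _. 1" "\<lambda>_. UNIV"]) (auto simp: True)
next
  case False
  then have ne: "- U \<noteq> {}"
    by auto
  have cl: "closed (- U)"
    using U by (simp add: closed_def)
  \<comment> \<open>For \<open>j > 0\<close> the shift by 1 leaves a strip along the complement of
    \<open>U\<close> where \<open>\<rho> j\<close> vanishes; this puts its support inside
    \<open>K j\<close>.\<close>
  define \<rho> where "\<rho> j x = max 0 (min 1 (real j * infdist x (- U) - 1))" for j x
  define K where "K j = {x. 1 \<le> real j * infdist x (- U)}" for j
  have lim: "(\<lambda>j. \<rho> j x) \<longlonglongrightarrow> indicator U x" for x
  proof (cases "x \<in> U")
    case True
    then have pos: "0 < infdist x (- U)"
      using in_closed_iff_infdist_zero[OF cl ne, of x] infdist_nonneg[of x "- U"] by (simp add: less_le)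
    obtain N :: nat where N: "2 < real N * infdist x (- U)"
      using reals_Archimedean3[OF pos] by blast
    have "\<rho> j x = 1" if "N \<le> j" for j
    proof -
      have "real N * infdist x (- U) \<le> real j * infdist x (- U)"
        using that pos by (intro mult_right_mono) auto
      then show ?thesis
        using N by (simp add: \<rho>_def)
    qed
    then have "\<forall>\<^sub>F j in sequentially. \<rho> j x = 1"
      unfolding eventually_sequentially by blast
    then show ?thesis
      using True by (simp add: tendsto_eventually)
  next
    case False
    then show ?thesis
      by (simp add: \<rho>_def)
  qed
  show ?thesis
  proof (rule that[of \<rho> K, OF _ _ _ lim])
    show "continuous_on UNIV (\<rho> j)" for j
      unfolding \<rho>_def[abs_def] by (intro continuous_intros)
    show "closed (K j)" for j
      unfolding K_def by (intro closed_Collect_le continuous_intros)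
    show "K j \<subseteq> U" for j
    proof
      fix x assume x: "x \<in> K j"
      show "x \<in> U"
      proof (rule ccontr)
        assume "x \<notin> U"
        then have "infdist x (- U) = 0"
          by simp
        then show False
          using x by (simp add: K_def)
      qed
    qed
  qed (auto simp: \<rho>_def K_def)
qed

lemma compatible_integral_isometry:
  fixes \<mu> :: "'a::metric_space measure" and \<rho> :: "'a \<Rightarrow> real"
  assumes \<mu>: "isometrically_compatible UNIV \<mu>" "finite_measure \<mu>"
    and f: "isometry_onto f U V" "open U" "open V"
    and \<rho>: "continuous_on UNIV \<rho>" "\<And>x. x \<notin> U \<Longrightarrow> \<rho> x = 0"
  shows "integral\<^sup>L \<mu> (\<lambda>y. indicator V y * \<rho> (inv_into U f y)) = integral\<^sup>L \<mu> \<rho>"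
proof -
  have bor: "sets \<mu> = sets borel"
    by (rule compatible_sets_UNIV[OF \<mu>(1)])
  have sp: "space \<mu> = UNIV"
    using sets_eq_imp_space_eq[OF bor] by simp
  have g: "inv_into U f \<in> restrict_space \<mu> V \<rightarrow>\<^sub>M restrict_space borel U"
    using isometry_onto_measurable[OF isometry_onto_inv_into[OF f(1)]]
      measurable_cong_sets[OF sets_restrict_compatible[OF \<mu>(1)] refl] by blast
  have \<rho>m: "\<rho> \<in> borel_measurable (restrict_space borel U)"
    using \<rho>(1) by (intro borel_measurable_continuous_on_restrict continuous_on_subset[OF \<rho>(1)]) auto
  have "integral\<^sup>L \<mu> (\<lambda>y. indicator V y * \<rho> (inv_into U f y)) = integral\<^sup>L (restrict_space \<mu> V) (\<lambda>y. \<rho> (inv_into U f y))"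
    using f(3) by (subst integral_restrict_space) (auto simp: bor sp)
  also have "\<dots> = integral\<^sup>L (distr (restrict_space \<mu> V) (restrict_space borel U) (inv_into U f)) \<rho>"
    by (rule integral_distr[symmetric, OF g \<rho>m])
  also have "\<dots> = integral\<^sup>L (restrict_space \<mu> U) \<rho>"
    by (simp add: compatible_distr_isometry[OF \<mu> f])
  also have "\<dots> = integral\<^sup>L \<mu> (\<lambda>x. indicator U x *\<^sub>R \<rho> x)"
    using f(2) by (subst integral_restrict_space) (auto simp: bor sp)
  also have "\<dots> = integral\<^sup>L \<mu> \<rho>"
    using \<rho>(2) by (intro Bochner_Integration.integral_cong) (auto simp: indicator_def)
  finally show ?thesis .
qed

text \<open>Measures of open sets do not pass to weak limits, but integrals of continuous functions
  do. The cut-off \<open>\<rho> j\<close> of \<open>U\<close> and its transport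
  \<open>\<psi> j\<close> to \<open>V\<close> have equal integrals under each
  \<open>\<mu> k\<close>; the limit in \<open>k\<close> is taken for fixed \<open>j\<close>, and
  then the limit in \<open>j\<close> by dominated convergence.\<close>

lemma compatible_weak_limit:
  fixes \<mu> :: "nat \<Rightarrow> 'a::metric_space measure"
  assumes compact: "compact (UNIV :: 'a set)"
    and \<mu>: "\<And>k. \<mu> k \<in> compatible_probs"
    and \<nu>: "prob_space \<nu>" "sets \<nu> = sets borel"
    and lim: "\<And>h :: 'a \<Rightarrow> real. continuous_on UNIV h \<Longrightarrow> (\<lambda>k. integral\<^sup>L (\<mu> k) h) \<longlonglongrightarrow> integral\<^sup>L \<nu> h"
  shows "\<nu> \<in> compatible_probs"
  unfolding compatible_probs_iff
proof (intro conjI allI impI \<nu>)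
  fix U V :: "'a set" and f
  assume UV: "open U" "open V" and f: "isometry_onto f U V"
  interpret prob_space \<nu> by fact
  obtain \<rho> :: "nat \<Rightarrow> 'a \<Rightarrow> real" and K :: "nat \<Rightarrow> 'a set"
    where \<rho>: "\<And>j. continuous_on UNIV (\<rho> j)" "\<And>j x. 0 \<le> \<rho> j x" "\<And>j x. \<rho> j x \<le> 1"
    "\<And>x. (\<lambda>j. \<rho> j x) \<longlonglongrightarrow> indicator U x"
    and K: "\<And>j. closed (K j)" "\<And>j. K j \<subseteq> U" "\<And>j x. x \<notin> K j \<Longrightarrow> \<rho> j x = 0"
    using open_cutoff[OF UV(1)] by metis
  define g where "g = inv_into U f"
  define \<psi> where "\<psi> j y = indicator V y * \<rho> j (g y)" for j y
  have V: "f ` U = V"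
    using f by (simp add: isometry_onto_def)
  have gU: "g y \<in> U" "f (g y) = y" if "y \<in> V" for y
    using that unfolding g_def V[symmetric] by (rule inv_into_into, rule f_inv_into_f)
  \<comment> \<open>The function is continuous on the open set \<open>V\<close> and zero off the
    image of \<open>K j\<close>, which is closed because \<open>K j\<close> is compact;
    \<open>V\<close> and the complement of that image cover the space.\<close>
  have \<psi>: "continuous_on UNIV (\<psi> j)" for j
  proof -
    have fK: "closed (f ` K j)" "f ` K j \<subseteq> V"
    proof -
      have "compact (K j)"
        using K(1) compact compact_Int_closed[of UNIV "K j"] by simp
      then have "compact (f ` K j)"
        using continuous_on_subset[OF isometry_onto_continuous_on[OF f] K(2)] by (rule compact_continuous_image[rotated])
      then show "closed (f ` K j)"
        by (rule compact_imp_closed)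
      show "f ` K j \<subseteq> V"
        using K(2) V by blast
    qed
    have "continuous_on V (\<lambda>y. \<rho> j (g y))"
      using isometry_onto_continuous_on[OF isometry_onto_inv_into[OF f]] continuous_on_subset[OF \<rho>(1)]
      unfolding g_def by (intro continuous_on_compose2[OF \<rho>(1)]) auto
    then have "continuous_on V (\<psi> j)"
      by (rule continuous_on_eq) (simp add: \<psi>_def)
    moreover have "\<psi> j y = 0" if "y \<notin> f ` K j" for y
    proof (cases "y \<in> V")
      case True
      then have "g y \<notin> K j"
        using that gU(2)[OF True] by (metis imageI)
      then show ?thesis
        using K(3) by (simp add: \<psi>_def)
    qed (simp add: \<psi>_def)
    then have "continuous_on (- (f ` K j)) (\<psi> j)"
      by (intro continuous_on_eq[OF continuous_on_const[of _ 0]]) auto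
    ultimately have "continuous_on (V \<union> - (f ` K j)) (\<psi> j)"
      using UV(2) fK(1) by (intro continuous_on_open_Un) (auto simp: open_Compl)
    moreover have "V \<union> - (f ` K j) = UNIV"
      using fK(2) by blast
    ultimately show ?thesis
      by simp
  qed
  have eq: "integral\<^sup>L \<nu> (\<psi> j) = integral\<^sup>L \<nu> (\<rho> j)" for j
  proof -
    have "integral\<^sup>L (\<mu> k) (\<psi> j) = integral\<^sup>L (\<mu> k) (\<rho> j)" for k
      unfolding \<psi>_def[abs_def] g_def
    proof (rule compatible_integral_isometry[OF _ _ f UV \<rho>(1)])
      show "isometrically_compatible UNIV (\<mu> k)"
        using \<mu>[of k] by (simp add: compatible_probs_def isometrically_compatible_prob_def)
      show "finite_measure (\<mu> k)"
        using \<mu>[of k] by (simp add: compatible_probs_iff prob_space.finite_measure)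
      show "\<rho> j x = 0" if "x \<notin> U" for x
        using K that by blast
    qed
    then show ?thesis
      using LIMSEQ_unique[OF lim[OF \<psi>[of j]]] lim[OF \<rho>(1)[of j]] by simp
  qed
  have \<psi>lim: "(\<lambda>j. \<psi> j y) \<longlonglongrightarrow> indicator V y" for y
  proof (cases "y \<in> V")
    case True
    then show ?thesis
      using \<rho>(4)[of "g y"] gU(1)[OF True] by (simp add: \<psi>_def)
  qed (simp add: \<psi>_def)
  have conv: "(\<lambda>j. integral\<^sup>L \<nu> (h j)) \<longlonglongrightarrow> measure \<nu> W"
    if h: "\<And>j. continuous_on UNIV (h j)" "\<And>j x. \<bar>h j x\<bar> \<le> 1" "\<And>x. (\<lambda>j. h j x) \<longlonglongrightarrow> indicator W x" and W: "open W"
    for h :: "nat \<Rightarrow> 'a \<Rightarrow> real" and W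
  proof -
    have m: "h j \<in> borel_measurable \<nu>" for j
      using borel_measurable_continuous_onI[OF h(1)] measurable_cong_sets[OF \<nu>(2) refl] by blast
    have Wm: "W \<in> sets \<nu>"
      using W \<nu>(2) by simp
    have "(\<lambda>j. integral\<^sup>L \<nu> (h j)) \<longlonglongrightarrow> integral\<^sup>L \<nu> (indicator W)"
      using h(2,3) Wm by (intro integral_dominated_convergence[where w = "\<lambda>_. 1"] m borel_measurable_indicator) auto
    then show ?thesis
      using Wm by simp
  qed
  have "(\<lambda>j. integral\<^sup>L \<nu> (\<rho> j)) \<longlonglongrightarrow> measure \<nu> U"
    using \<rho> UV by (intro conv) auto
  moreover have "(\<lambda>j. integral\<^sup>L \<nu> (\<psi> j)) \<longlonglongrightarrow> measure \<nu> V"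
    using \<rho>(2,3) by (intro conv \<psi> \<psi>lim UV) (auto simp: \<psi>_def indicator_def)
  ultimately show "measure \<nu> U = measure \<nu> V"
    unfolding eq by (rule LIMSEQ_unique)
qed

text \<open>Sequential arguments are legitimate only in a metrisable setting. The integrals of a
  countable dense family place the probabilities in the metrisable product of countably many real
  lines; there sequential compactness is compactness, and it is transported back by a continuous
  map.\<close>

lemma compactin_compatible_probs:
  assumes compact: "compact (UNIV :: 'a::metric_space set)"
  shows "compactin weak_star_topology (dual_functional ` (compatible_probs :: 'a measure set))"
proof -
  obtain F :: "nat \<Rightarrow> 'a \<Rightarrow>\<^sub>C real"
    where F: "\<And>f e. 0 < e \<Longrightarrow> \<exists>i. \<forall>x. \<bar>apply_bcontfun (F i) x - apply_bcontfun f x\<bar> \<le> e"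
    using countable_uniformly_dense_bcontfun[OF compact] by metis
  define S where "S = (compatible_probs :: 'a measure set)"
  have S: "prob_space m" "finite_measure m" "sets m = sets borel" if "m \<in> S" for m
    using that by (auto simp: S_def compatible_probs_iff prob_space.finite_measure)
  have dual: "blinfun_apply (dual_functional m) f = integral\<^sup>L m (apply_bcontfun f)" if "m \<in> S" for m f
    using S[OF that] by (intro dual_functional_apply)
  have near: "\<bar>integral\<^sup>L m (apply_bcontfun f) - integral\<^sup>L m (apply_bcontfun f')\<bar> \<le> e"
    if m: "m \<in> S" and e: "\<And>x. \<bar>apply_bcontfun f x - apply_bcontfun f' x\<bar> \<le> e" for m e and f f' :: "'a \<Rightarrow>\<^sub>C real"
  proof -
    interpret prob_space m by (rule S(1)[OF m])
    note int = integrable_bcontfun[OF S(3)[OF m] finite_measure_axioms]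
    have "\<bar>integral\<^sup>L m (apply_bcontfun f) - integral\<^sup>L m (apply_bcontfun f')\<bar> =
        \<bar>integral\<^sup>L m (\<lambda>x. apply_bcontfun f x - apply_bcontfun f' x)\<bar>"
      by (simp add: int)
    also have "\<dots> \<le> integral\<^sup>L m (\<lambda>x. \<bar>apply_bcontfun f x - apply_bcontfun f' x\<bar>)"
      by (rule integral_abs_bound)
    also have "\<dots> \<le> integral\<^sup>L m (\<lambda>x. e)"
      by (intro integral_mono e) (auto simp: int)
    also have "\<dots> = e"
      by (simp add: prob_space)
    finally show ?thesis .
  qed
  define T where "T m i = integral\<^sup>L m (apply_bcontfun (F i))" for m :: "'a measure" and i
  define X where "X = T ` S"
  have inj: "dual_functional m = dual_functional n" if mn: "m \<in> S" "n \<in> S" "T m = T n" for m n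
  proof (rule blinfun_eqI)
    fix f :: "'a \<Rightarrow>\<^sub>C real"
    have "\<bar>integral\<^sup>L m (apply_bcontfun f) - integral\<^sup>L n (apply_bcontfun f)\<bar> \<le> e" if e: "0 < e" for e
    proof -
      obtain i where i: "\<And>x. \<bar>apply_bcontfun (F i) x - apply_bcontfun f x\<bar> \<le> e / 2"
        using F[of "e / 2" f] e by auto
      have "T m i = T n i"
        using mn(3) by simp
      then show ?thesis
        using near[OF mn(1) i] near[OF mn(2) i] unfolding T_def by linarith
    qed
    then have "integral\<^sup>L m (apply_bcontfun f) = integral\<^sup>L n (apply_bcontfun f)"
      by (metis abs_le_zero_iff eq_iff_diff_eq_0 field_le_epsilon add_0)
    then show "blinfun_apply (dual_functional m) f = blinfun_apply (dual_functional n) f"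
      by (simp add: dual mn)
  qed
  have "seq_compact X"
    unfolding seq_compact_def
  proof (intro allI impI)
    fix v :: "nat \<Rightarrow> nat \<Rightarrow> real" assume "\<forall>k. v k \<in> X"
    then have "\<forall>k. \<exists>m\<in>S. v k = T m"
      by (auto simp: X_def)
    then obtain \<mu> where \<mu>: "\<And>k. \<mu> k \<in> S" "\<And>k. v k = T (\<mu> k)"
      by metis
    obtain r and \<nu> :: "'a measure" where r: "strict_mono (r :: nat \<Rightarrow> nat)" and \<nu>: "prob_space \<nu>" "sets \<nu> = sets borel"
      and lim: "\<And>f :: 'a \<Rightarrow> real. continuous_on UNIV f \<Longrightarrow> (\<lambda>k. integral\<^sup>L (\<mu> (r k)) f) \<longlonglongrightarrow> integral\<^sup>L \<nu> f"
      by (rule prob_sequence_weak_limit[where \<mu> = \<mu>, OF compact S(1)[OF \<mu>(1)] S(3)[OF \<mu>(1)]])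
        (rule that)
    have "\<nu> \<in> S"
      unfolding S_def using \<mu>(1) by (intro compatible_weak_limit[OF compact _ \<nu> lim]) (auto simp: S_def)
    moreover have "(\<lambda>k. T (\<mu> (r k)) i) \<longlonglongrightarrow> T \<nu> i" for i
      unfolding T_def by (intro lim continuous_on_apply_bcontfun)
    then have "limitin (product_topology (\<lambda>_. euclidean) UNIV) (v \<circ> r) (T \<nu>) sequentially"
      by (simp add: limitin_componentwise \<mu>(2) o_def)
    then have "(v \<circ> r) \<longlonglongrightarrow> T \<nu>"
      by (simp add: euclidean_product_topology)
    ultimately show "\<exists>l\<in>X. \<exists>r. strict_mono r \<and> (v \<circ> r) \<longlonglongrightarrow> l"
      using r by (auto simp: X_def)
  qed
  then have "compact X"
    by (simp add: compact_eq_seq_compact_metric)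
  \<comment> \<open>The choice of \<open>m\<close> is immaterial: by \<open>inj\<close>, the
    sequence of integrals determines the functional.\<close>
  define h where "h v = dual_functional (SOME m. m \<in> S \<and> v = T m)" for v
  have h: "h (T m) = dual_functional m" if "m \<in> S" for m
  proof -
    have "(SOME n. n \<in> S \<and> T m = T n) \<in> S \<and> T m = T (SOME n. n \<in> S \<and> T m = T n)"
      by (rule someI[of _ m]) (simp add: that)
    then show ?thesis
      unfolding h_def using inj[OF _ that] by metis
  qed
  \<comment> \<open>Evaluation at \<open>f\<close> is a uniform limit on \<open>X\<close> of the
    coordinates \<open>v (i k)\<close>, because \<open>F (i k)\<close> tends to \<open>f\<close>
    uniformly and all masses are 1.\<close>
  have "continuous_on X (\<lambda>v. blinfun_apply (h v) f)" for f
  proof -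
    have "\<exists>i. \<forall>x. \<bar>apply_bcontfun (F i) x - apply_bcontfun f x\<bar> \<le> 1 / Suc k" for k
      by (rule F) simp
    then obtain i where i: "\<And>k x. \<bar>apply_bcontfun (F (i k)) x - apply_bcontfun f x\<bar> \<le> 1 / Suc k"
      by metis
    have bound: "\<bar>v (i k) - blinfun_apply (h v) f\<bar> \<le> 1 / Suc k" if v: "v \<in> X" for v k
    proof -
      obtain m where m: "m \<in> S" "v = T m"
        using v by (auto simp: X_def)
      show ?thesis
        using near[OF m(1) i[of k]] unfolding m(2) h[OF m(1)] dual[OF m(1)] T_def .
    qed
    show ?thesis
    proof (rule uniform_limit_theorem)
      show "\<forall>\<^sub>F k in sequentially. continuous_on X (\<lambda>v. v (i k))"
        by (intro always_eventually allI continuous_on_subset[OF continuous_on_product_coordinates]) auto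
      show "uniform_limit X (\<lambda>k v. v (i k)) (\<lambda>v. blinfun_apply (h v) f) sequentially"
      proof (rule uniform_limitI)
        fix e :: real assume "0 < e"
        then have "\<forall>\<^sub>F k in sequentially. 1 / real (Suc k) < e"
          using order_tendstoD(2)[OF LIMSEQ_inverse_real_of_nat] by (simp add: inverse_eq_divide)
        then show "\<forall>\<^sub>F k in sequentially. \<forall>v\<in>X. dist (v (i k)) (blinfun_apply (h v) f) < e"
          by eventually_elim (use bound in \<open>auto simp: dist_real_def intro: le_less_trans\<close>)
      qed
    qed simp
  qed
  then have "continuous_map (top_of_set X) weak_star_topology h"
    by (simp add: continuous_on_strong_operator_topo_iff_coordinatewise)
  moreover have "compactin (top_of_set X) X"
    using \<open>compact X\<close> by (simp add: compactin_subtopology)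
  ultimately have "compactin weak_star_topology (h ` X)"
    by (rule image_compactin[rotated])
  moreover have "h ` X = dual_functional ` S"
    using h by (force simp: X_def image_image)
  ultimately show ?thesis
    by (simp add: S_def)
qed

theorem theorem9:
  assumes compact_space: "compact (UNIV :: 'a::metric_space set)"
    and countable_components: "countable (homogeneous_components :: 'a set set)"
  shows
    "(\<forall>C \<in> (admissible_components :: 'a set set). \<exists>!m. isometrically_compatible_prob C m) \<and>
     (\<forall>\<mu> :: 'a measure.
        isometrically_compatible_prob UNIV \<mu> \<longleftrightarrow>
        (\<exists>l :: 'a set \<Rightarrow> real.
           (\<forall>C \<in> admissible_components. 0 \<le> l C) \<and>
           (l has_sum 1) admissible_components \<and>
           sets \<mu> = sets borel \<and>
           (\<forall>B \<in> sets borel.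
              emeasure \<mu> B =
                (\<Sum>\<^sub>\<infinity>C\<in>admissible_components.
                   ennreal (l C) * emeasure (component_prob C) (B \<inter> C))))) \<and>
     compactin weak_star_topology (dual_functional ` (compatible_probs :: 'a measure set)) \<and>
     convex (dual_functional ` (compatible_probs :: 'a measure set)) \<and>
     {\<phi>. \<phi> extreme_point_of (dual_functional ` (compatible_probs :: 'a measure set))} =
       dual_functional ` {\<mu> \<in> compatible_probs. \<exists>C \<in> homogeneous_components.
         (\<exists>m. isometrically_compatible_prob C m) \<and> (AE x in \<mu>. x \<in> C)}"
  by (intro conjI ballI allI admissible_component_prob[OF assms] compatible_prob_iff[OF assms]
      compactin_compatible_probs[OF compact_space] convex_compatible_probs
      extreme_compatible_probs[OF assms])

end
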